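(* For every dimension $n\ge1$ there exists a constant $c$ depending only on $n$ such that for every $p\ge 1$ (with $p<\infty$), every weight $v\in A_p$ on $\mathbb{R}^n$ and every $f\in L^1(v)$, $$\left\| \frac{M_d (fv)}{v} \right\|_{L^{1, \infty}(v)}\le c\,p\,[v]_{(A_p)^{1/p}(A^{exp}_\infty)^{1/p'}}\log\!\left(e+[v]_{(A_p)^{1/p}(A^{exp}_\infty)^{1/p'}}\right) \|f\|_{L^1(v)}.$$
   Context: A weight is a nonnegative locally integrable function on $\mathbb{R}^n$. Cubes have sides parallel to the coordinate axes. For a weight $w$ and a cube $Q$: for $1<p<\infty$, $A_p(w;Q)=\left(\frac1{|Q|}\int_Q w\right)\left(\frac1{|Q|}\int_Q w^{1-p'}\right)^{p-1}$ with $p'=p/(p-1)$; $A_1(w;Q)=\left(\frac1{|Q|}\int_Q w\right)(\operatorname{ess\,inf}_Q w)^{-1}$; and $A_\infty^{exp}(w;Q)=\left(\frac1{|Q|}\int_Q w\right)\exp\left(\frac1{|Q|}\int_Q\log w^{-1}\right)$. $[w]_{A_p}=\sup_Q A_p(w;Q)$, and $w\in A_p$ means $[w]_{A_p}<\infty$. The mixed constant is $[w]_{(A_p)^{\alpha}(A_\infty^{exp})^{\beta}}=\sup_Q A_p(w;Q)^{\alpha}A_\infty^{exp}(w;Q)^{\beta}$ (with $1/p'=0$ when $p=1$). $M_d$ is the dyadic maximal operator, $M_d h(x)=\sup_{Q\ni x}\frac1{|Q|}\int_Q|h|$, the supremum over dyadic cubes containing $x$. $\|f\|_{L^1(v)}=\int|f|\,v\,dx$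 and $\|F\|_{L^{1,\infty}(v)}=\sup_{t>0} t\, v(\{x:|F(x)|>t\})$, where $v(E)=\int_E v\,dx$. *)

theory Defs
  imports "HOL-Analysis.Analysis"
begin

text \<open>All the constants below are suprema or averages that may be infinite, so they live in
  \<^typ>\<open>ennreal\<close>; there \<open>0 * top = 0\<close>, \<open>inverse 0 = top\<close> and \<open>a / 0 = top\<close> for \<open>a > 0\<close>.\<close>

text \<open>Powers with the conventions \<open>x\<^sup>0 = 1\<close> for every \<open>x\<close> (also \<open>top\<close>), and
  \<open>0\<^sup>a = top\<close> for \<open>a < 0\<close> (in contrast to \<open>0 powr a = 0\<close> on the reals).\<close>

definition epowr :: "ennreal \<Rightarrow> real \<Rightarrow> ennreal" where
  "epowr x a =
     (if a = 0 then 1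
      else if x = 0 then (if a < 0 then top else 0)
      else if x = top then (if a < 0 then 0 else top)
      else ennreal (enn2real x powr a))"

definition exp_ereal :: "ereal \<Rightarrow> ennreal" where
  "exp_ereal x = (case x of ereal r \<Rightarrow> ennreal (exp r) | PInfty \<Rightarrow> top | MInfty \<Rightarrow> 0)"

definition ln_e_plus :: "ennreal \<Rightarrow> ennreal" where
  "ln_e_plus x = (if x = top then top else ennreal (ln (exp 1 + enn2real x)))"

definition cubes :: "(real ^ 'n) set set" where
  "cubes = {cbox a (a + (\<chi> i. l)) | a l. 0 < l}"

definition dyadic_cubes :: "(real ^ 'n) set set" where
  "dyadic_cubes =
     {{x. \<forall>i. 2 powi k * of_int (j $ i) \<le> x $ i \<and> x $ i < 2 powi k * (of_int (j $ i) + 1)}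
      | (k :: int) (j :: int ^ 'n). True}"

definition avg :: "(real ^ 'n) set \<Rightarrow> (real ^ 'n \<Rightarrow> ennreal) \<Rightarrow> ennreal" where
  "avg Q h = (\<integral>\<^sup>+x\<in>Q. h x \<partial>lebesgue) / emeasure lebesgue Q"

text \<open>Average of a function with values of both signs, as average of the positive part minus
  average of the negative part (\<^const>\<open>e2ennreal\<close> sends negative numbers to \<open>0\<close>); meaningful
  as soon as one of the two is finite.\<close>

definition signed_avg :: "(real ^ 'n) set \<Rightarrow> (real ^ 'n \<Rightarrow> ereal) \<Rightarrow> ereal" where
  "signed_avg Q g =
     enn2ereal (avg Q (\<lambda>x. e2ennreal (g x))) - enn2ereal (avg Q (\<lambda>x. e2ennreal (- g x)))"

definition ess_inf_on :: "(real ^ 'n) set \<Rightarrow> (real ^ 'n \<Rightarrow> ennreal) \<Rightarrow> ennreal" where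
  "ess_inf_on Q h = Sup {z. AE x in lebesgue. x \<in> Q \<longrightarrow> z \<le> h x}"

definition weight :: "(real ^ 'n \<Rightarrow> real) \<Rightarrow> bool" where
  "weight w \<longleftrightarrow> (\<forall>x. 0 \<le> w x) \<and> (\<forall>K. compact K \<longrightarrow> set_integrable lebesgue K w)"

text \<open>The measure \<open>w dx\<close>, so that \<open>w(E) = \<integral>\<^sub>E w dx\<close>.\<close>

definition weight_measure :: "(real ^ 'n \<Rightarrow> real) \<Rightarrow> (real ^ 'n) measure" where
  "weight_measure w = density lebesgue (\<lambda>x. ennreal (w x))"

text \<open>For \<open>p = 1\<close> division by zero gives \<open>conj_exp 1 = 0\<close>, hence \<open>1 / conj_exp 1 = 0\<close>,
  which is the intended value of \<open>1/p'\<close>.\<close>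

definition conj_exp :: "real \<Rightarrow> real" where
  "conj_exp p = p / (p - 1)"

definition Ap_on :: "real \<Rightarrow> (real ^ 'n \<Rightarrow> real) \<Rightarrow> (real ^ 'n) set \<Rightarrow> ennreal" where
  "Ap_on p w Q =
     (if p = 1
      then avg Q (\<lambda>x. ennreal (w x)) * inverse (ess_inf_on Q (\<lambda>x. ennreal (w x)))
      else avg Q (\<lambda>x. ennreal (w x)) *
           epowr (avg Q (\<lambda>x. epowr (ennreal (w x)) (1 - conj_exp p))) (p - 1))"

definition ln_inverse :: "real \<Rightarrow> ereal" where
  "ln_inverse t = (if t = 0 then \<infinity> else ereal (ln (1 / t)))"

text \<open>For a weight the negative part of \<open>log w\<^sup>-\<^sup>1\<close> is bounded by \<open>w\<close>, hence integrable on
  cubes, so the signed average is well defined, with value in \<open>(-\<infinity>, \<infinity>]\<close>.\<close>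

definition Ainf_exp_on :: "(real ^ 'n \<Rightarrow> real) \<Rightarrow> (real ^ 'n) set \<Rightarrow> ennreal" where
  "Ainf_exp_on w Q =
     avg Q (\<lambda>x. ennreal (w x)) * exp_ereal (signed_avg Q (\<lambda>x. ln_inverse (w x)))"

definition Ap_const :: "real \<Rightarrow> (real ^ 'n \<Rightarrow> real) \<Rightarrow> ennreal" where
  "Ap_const p w = (SUP Q\<in>cubes. Ap_on p w Q)"

definition in_Ap :: "real \<Rightarrow> (real ^ 'n \<Rightarrow> real) \<Rightarrow> bool" where
  "in_Ap p w \<longleftrightarrow> weight w \<and> Ap_const p w < top"

definition mixed_const :: "real \<Rightarrow> real \<Rightarrow> real \<Rightarrow> (real ^ 'n \<Rightarrow> real) \<Rightarrow> ennreal" where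
  "mixed_const p \<alpha> \<beta> w = (SUP Q\<in>cubes. epowr (Ap_on p w Q) \<alpha> * epowr (Ainf_exp_on w Q) \<beta>)"

definition dyadic_maximal :: "(real ^ 'n \<Rightarrow> real) \<Rightarrow> real ^ 'n \<Rightarrow> ennreal" where
  "dyadic_maximal h x = (SUP Q\<in>{Q \<in> dyadic_cubes. x \<in> Q}. avg Q (\<lambda>y. ennreal \<bar>h y\<bar>))"

definition L1_norm :: "(real ^ 'n \<Rightarrow> real) \<Rightarrow> (real ^ 'n \<Rightarrow> real) \<Rightarrow> ennreal" where
  "L1_norm v f = (\<integral>\<^sup>+x. ennreal (\<bar>f x\<bar> * v x) \<partial>lebesgue)"

text \<open>Stated for \<open>F \<ge> 0\<close> with possibly infinite values, so \<open>F = \<bar>F\<bar>\<close>.\<close>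

definition weak_L1_norm :: "(real ^ 'n \<Rightarrow> real) \<Rightarrow> (real ^ 'n \<Rightarrow> ennreal) \<Rightarrow> ennreal" where
  "weak_L1_norm v F =
     (SUP t\<in>{0::real<..}. ennreal t * emeasure (weight_measure v) {x. ennreal t < F x})"

end

theory Submission
  imports Defs
begin

text \<open>
  Put $q = p'$ (and $q = 2$ if $p = 1$), $\sigma = v^{1-q}$, $h = \sqrt v$ and $g = |f| v / t$,
  write $w_Q$ for the average of $w$ over $Q$, and let $B$ be the mixed constant. Jensen's inequality
  turns the exponential factor into $h_Q^{-2}$, so that the hypothesis becomes
  $v_Q^q \sigma_Q \le B^q h_Q^2$ on every dyadic cube. Descend the dyadic tree and keep track of
  the running maxima $P$ of $g_Q$ and $U$ of $u_Q = g_Q / v_Q$. Cubes with $u_Q > \lambda$ carry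
  $v$-mass at most $\lambda^{-1} \int g$. Otherwise
  $v \{x \in Q : v(x) < P\} \le P^q \int_Q \sigma$, and the increments of the right-hand side
  are controlled by those of $h_Q^2 / (1 + g_Q / P)$, because $h^2 / (1 + g / P)$ is jointly convex
  in $(h, g)$ and increases with $P$; the growth of the weight $U^q$ is paid for by
  $q' (\lambda^{q-1} - U^{q-1}) \int_Q g$. With $\lambda = 1 / (e B)$ this gives the weak type
  bound with a constant of order $p B$, independent of the dimension and without the logarithm.
\<close>

section \<open>A Bellman function on trees\<close>

text \<open>The obstacle is to add up the cost of raising \<open>P\<close> over all scales. On one
  cube it is at most \<open>g_Q^q\<close> times the integral of sigma, hence at most
  \<open>(B u_Q)^q |Q| h_Q^2\<close>, and the sums of \<open>|Q| h_Q^2\<close> over successive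
  generations do not decay. The quotient \<open>|Q| h_Q^2 / (1 + g_Q / P)\<close> makes the costs
  telescope: each rise of \<open>P\<close> lifts it by a comparable amount, subdivision can only
  lift it further, and it never exceeds the \<open>v\<close>-mass because
  \<open>h_Q^2 <= v_Q\<close>. This explains the square root: its integrals add up over children,
  which the exponential mean does not do. The factor \<open>U^q\<close> is there because
  \<open>g_Q = u_Q v_Q\<close>.

  The descent starts with \<open>P = U = 0\<close>, where only \<open>1 / lam\<close> and a multiple
  of \<open>B^q lam^(q-1)\<close> remain in front of the integral of \<open>g\<close>. Both have
  size \<open>B\<close> for \<open>lam\<close> near \<open>1 / B\<close>; the extra \<open>e\<close>
  absorbs a factor \<open>q\<close>, since \<open>q e^(1-q) <= 1\<close>. What survives is
  \<open>q / (q - 1)\<close>, equal to \<open>p\<close> when \<open>p > 1\<close>: this is the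
  linear growth in \<open>p\<close>.\<close>

lemma powr_ge_tangent:
  fixes x q :: real
  assumes "0 \<le> x" "1 \<le> q"
  shows "1 + q * (x - 1) \<le> x powr q"
proof (cases "x = 0")
  case False
  with assms have "(x powr q) powr (1/q) * 1 powr (1 - 1/q) \<le> (1/q) * x powr q + (1 - 1/q) * 1"
    by (intro Youngs_inequality_0) auto
  with assms False have "x \<le> (1/q) * x powr q + (1 - 1/q)" by (simp add: powr_powr)
  from mult_left_mono[OF this, of q] assms show ?thesis by (simp add: algebra_simps)
qed (use assms in auto)

text \<open>For \<open>r <= 1\<close> this compares the integrals over \<open>[r, 1]\<close> of
  \<open>q s^(q-1)\<close> and \<open>q s^(q-2)\<close>. Young's inequality, applied to
  \<open>r^q\<close> and \<open>1\<close>, gives it for every \<open>r\<close> at once.\<close>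

lemma one_minus_powr_le:
  fixes r q :: real
  assumes "0 \<le> r" "1 < q"
  shows "1 - r powr q \<le> q / (q - 1) * (1 - r powr (q - 1))"
proof (cases "r = 0")
  case False
  with assms have "(r powr q) powr ((q-1)/q) * 1 powr (1/q) \<le> ((q-1)/q) * r powr q + (1/q) * 1"
    by (intro Youngs_inequality_0) (auto simp: field_simps)
  with assms False have "r powr (q - 1) \<le> ((q-1)/q) * r powr q + (1/q)"
    by (simp add: powr_powr)
  with assms show ?thesis by (simp add: field_simps)
qed (use assms in auto)

text \<open>The function \<open>a^2 / b\<close> is convex and homogeneous of degree one; its tangent
  plane along the ray \<open>a = t b\<close> is the linear minorant \<open>2 t a - t^2 b\<close>,
  which can be summed. If \<open>I\<close> is empty or infinite, then \<open>sum b I = 0\<close> and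
  the left side is \<open>0\<close> by division by zero.\<close>

lemma square_sum_div_le:
  fixes a b :: "'i \<Rightarrow> real"
  assumes "\<And>i. i \<in> I \<Longrightarrow> 0 < b i"
  shows "(sum a I)\<^sup>2 / sum b I \<le> (\<Sum>i\<in>I. (a i)\<^sup>2 / b i)"
proof (cases "sum b I = 0")
  case False
  define t where "t = sum a I / sum b I"
  have "2 * t * a i - t\<^sup>2 * b i \<le> (a i)\<^sup>2 / b i" if "i \<in> I" for i
  proof -
    have "0 \<le> (a i - t * b i)\<^sup>2 / b i" using assms[OF that] by simp
    also have "\<dots> = (a i)\<^sup>2 / b i - (2 * t * a i - t\<^sup>2 * b i)"
      using assms[OF that] by (simp add: power2_eq_square field_simps)
    finally show ?thesis by simp
  qed
  then have "(\<Sum>i\<in>I. 2 * t * a i - t\<^sup>2 * b i) \<le> (\<Sum>i\<in>I. (a i)\<^sup>2 / b i)"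
    by (rule sum_mono)
  moreover have "(\<Sum>i\<in>I. 2 * t * a i - t\<^sup>2 * b i) = 2 * t * sum a I - t\<^sup>2 * sum b I"
    by (simp add: sum_subtractf sum_distrib_left)
  moreover have "\<dots> = (sum a I)\<^sup>2 / sum b I"
    using False by (simp add: t_def power2_eq_square field_simps)
  ultimately show ?thesis by simp
next
  case True
  then show ?thesis using assms by (simp add: sum_nonneg less_imp_le)
qed

text \<open>All cube quantities are totals, not averages: \<open>vol\<close>, \<open>V\<close>, \<open>G\<close>, \<open>S\<close>, \<open>H\<close> are the
  integrals of $1, v, g, \sigma, h$ over the cube. The quotient is $|Q| h_Q^2 / (1 + g_Q / P)$,
  written so that \<open>P = 0\<close> gives \<open>0\<close> (also for \<open>G = 0\<close>, by \<open>0 / 0 = 0\<close>).\<close>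

definition bellman :: "real \<Rightarrow> real \<Rightarrow> real \<Rightarrow> real \<Rightarrow> real \<Rightarrow> real \<Rightarrow> real \<Rightarrow> real \<Rightarrow> real \<Rightarrow> real \<Rightarrow> real" where
  "bellman q K lam P U vol V G S H =
     P powr q * S
     + 4 * q * K * (U powr q * (V - H\<^sup>2 * P / (P * vol + G))
                    + q / (q - 1) * (lam powr (q - 1) - U powr (q - 1)) * G)
     + G / lam"

text \<open>Raising \<open>P\<close> to \<open>g = G / vol\<close> moves the quotient from
  \<open>H^2 / vol * (P / (P + g))\<close> to \<open>H^2 / vol * (1 / 2)\<close>, and this drop of
  the bracket pays for the growth of \<open>P^q S\<close>. The assumption on \<open>U\<close> serves
  to turn \<open>g^q S = (G / V)^q (V / vol)^q S\<close> into a multiple of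
  \<open>U^q H^2 / vol\<close>.\<close>

lemma bellman_max_level:
  fixes q K lam P U vol V G S H :: real
  assumes "1 < q" "0 \<le> K" "0 \<le> P" "0 < vol" "0 < V" "0 \<le> G" "0 \<le> S"
    and key: "(V / vol) powr q * S \<le> K * H\<^sup>2 / vol"
    and U: "G / V \<le> U"
  shows "bellman q K lam (max P (G / vol)) U vol V G S H \<le> bellman q K lam P U vol V G S H"
proof (cases "G / vol \<le> P")
  case False
  define g where "g = G / vol"
  have g: "P < g" "0 < g" "G = g * vol" using False assms by (auto simp: g_def)
  have "1 + q * (P / g - 1) \<le> (P / g) powr q"
    using assms g by (intro powr_ge_tangent) auto
  then have "g powr q * (1 + q * (P / g - 1)) \<le> g powr q * (P / g) powr q"
    by (rule mult_left_mono) auto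
  also have "g powr q * (P / g) powr q = P powr q"
    using assms g by (simp add: powr_divide)
  finally have 1: "g powr q - P powr q \<le> q * (1 - P / g) * g powr q"
    by (simp add: algebra_simps)
  have "g powr q = (G / V) powr q * (V / vol) powr q"
    using assms by (simp add: g_def flip: powr_mult)
  then have "g powr q * S = (G / V) powr q * ((V / vol) powr q * S)" by simp
  also have "\<dots> \<le> U powr q * (K * H\<^sup>2 / vol)"
    using assms key by (intro mult_mono powr_mono2) auto
  finally have 2: "g powr q * S \<le> U powr q * (K * H\<^sup>2 / vol)" .
  have "(g powr q - P powr q) * S \<le> q * (1 - P / g) * g powr q * S"
    using 1 \<open>0 \<le> S\<close> by (rule mult_right_mono)
  also have "\<dots> = q * (1 - P / g) * (g powr q * S)" by simp
  also have "\<dots> \<le> q * (1 - P / g) * (U powr q * (K * H\<^sup>2 / vol))"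
    using 2 g assms by (intro mult_left_mono) auto
  also have "\<dots> = (1 - P / g) * (q * K * U powr q * (H\<^sup>2 / vol))" by simp
  \<comment> \<open>Here \<open>1/2 - P / (P + g) = (g - P) / (2 (P + g))\<close> and
    \<open>P + g <= 2 g\<close>, which is the origin of the factor \<open>4\<close> in
    \<open>bellman\<close>; its companion \<open>q\<close> is the slope of the tangent to
    \<open>x^q\<close> at \<open>1\<close>.\<close>
  also have "\<dots> \<le> (4 * (1 / 2 - P / (P + g))) * (q * K * U powr q * (H\<^sup>2 / vol))"
  proof (rule mult_right_mono)
    have "4 * (1 / 2 - P / (P + g)) = 2 * (g - P) / (P + g)"
      using g assms by (simp add: field_simps)
    moreover have "1 - P / g = (g - P) / g" using g by (simp add: field_simps)
    moreover have "(g - P) / g \<le> 2 * (g - P) / (P + g)"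
      using g assms frac_le[of "g - P" "g - P" "(P + g) / 2" g] by (simp add: algebra_simps)
    ultimately show "1 - P / g \<le> 4 * (1 / 2 - P / (P + g))" by simp
  qed (use assms in auto)
  also have "\<dots> = 4 * q * K * (U powr q * (H\<^sup>2 * g / (g * vol + G) - H\<^sup>2 * P / (P * vol + G)))"
  proof -
    have "H\<^sup>2 * g / (g * vol + G) = H\<^sup>2 / vol * (1 / 2)"
      using g assms by (simp add: field_simps)
    moreover have "H\<^sup>2 * P / (P * vol + G) = H\<^sup>2 / vol * (P / (P + g))"
      using g assms by (simp add: field_simps)
    moreover have "(4 * (1 / 2 - y)) * (q * K * w * z) = 4 * q * K * (w * (z * (1 / 2) - z * y))"
      for w y z :: real by (simp add: algebra_simps)
    ultimately show ?thesis by (simp only:)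
  qed
  finally have 3: "(g powr q - P powr q) * S
    \<le> 4 * q * K * (U powr q * (H\<^sup>2 * g / (g * vol + G) - H\<^sup>2 * P / (P * vol + G)))" .
  have rearrange: "a * S + c * (w * (V - x) + k) + l \<le> b * S + c * (w * (V - y) + k) + l"
    if "(a - b) * S \<le> c * (w * (x - y))" for a b c k l w x y :: real
    using that by (simp add: algebra_simps)
  show ?thesis
    using rearrange[OF 3] g(1) unfolding bellman_def g_def[symmetric] by (simp add: max_def)
qed (simp add: max_def)

text \<open>Keeps the bracket multiplied by \<open>U^q\<close> in \<open>bellman\<close>
  nonnegative.\<close>

lemma weighted_square_le:
  fixes P vol V G H :: real
  assumes "0 \<le> P" "0 < vol" "0 < V" "0 \<le> G" "H\<^sup>2 \<le> vol * V"
  shows "H\<^sup>2 * P / (P * vol + G) \<le> V"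
proof (cases "P * vol + G = 0")
  case False
  then have "0 < P * vol + G" using assms by (simp add: order_less_le)
  moreover have "H\<^sup>2 * P \<le> vol * V * P" using assms by (intro mult_right_mono) auto
  moreover have "0 \<le> V * G" using assms by simp
  ultimately show ?thesis by (simp add: divide_le_eq algebra_simps)
qed (use assms in auto)

text \<open>The bracket next to \<open>U^q\<close> is at most \<open>V\<close>, so raising
  \<open>U\<close> to \<open>u\<close> costs at most \<open>(u^q - U^q) V\<close>. By
  \<open>one_minus_powr_le\<close> with \<open>r = U / u\<close> this is at most
  \<open>q / (q - 1) * (u^(q-1) - U^(q-1)) * u V\<close>, and as \<open>u V = G\<close> it is
  exactly what the last term of the bracket gives back.\<close>

lemma bellman_max_slope:
  fixes q K lam P U vol V G S H :: real
  assumes "1 < q" "0 \<le> K" "0 \<le> P" "0 \<le> U" "0 < vol" "0 < V" "0 \<le> G"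
  shows "bellman q K lam P (max U (G / V)) vol V G S H \<le> bellman q K lam P U vol V G S H"
proof (cases "G / V \<le> U")
  case False
  define u where "u = G / V"
  have u: "U < u" "0 < u" "G = u * V" using False assms by (auto simp: u_def)
  have "1 - (U / u) powr q \<le> q / (q - 1) * (1 - (U / u) powr (q - 1))"
    using assms u by (intro one_minus_powr_le) auto
  then have "u powr q * (1 - (U / u) powr q) \<le> u powr q * (q / (q - 1) * (1 - (U / u) powr (q - 1)))"
    by (rule mult_left_mono) auto
  moreover have "u powr q * (1 - (U / u) powr q) = u powr q - U powr q"
    using u assms by (simp add: powr_divide algebra_simps)
  moreover have "u powr q * (1 - (U / u) powr (q - 1)) = u * (u powr (q - 1) - U powr (q - 1))"
    using u assms by (simp add: powr_divide powr_diff field_simps)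
  ultimately have 1: "u powr q - U powr q \<le> q / (q - 1) * (u powr (q - 1) - U powr (q - 1)) * u"
    by (simp add: mult.commute mult.left_commute)
  have rearrange: "a * x + c * (l - d) * y \<le> b * x + c * (l - e) * y"
    if "(a - b) * x \<le> c * (d - e) * y" for a b c d e l x y :: real
    using that by (simp add: algebra_simps)
  have "0 \<le> H\<^sup>2 * P / (P * vol + G)" using assms by auto
  then have "(u powr q - U powr q) * (V - H\<^sup>2 * P / (P * vol + G)) \<le> (u powr q - U powr q) * V"
    using assms u by (intro mult_left_mono) (auto intro: powr_mono2)
  also have "\<dots> \<le> q / (q - 1) * (u powr (q - 1) - U powr (q - 1)) * u * V"
    using 1 assms by (intro mult_right_mono) auto
  finally have "(u powr q - U powr q) * (V - H\<^sup>2 * P / (P * vol + G))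
      \<le> q / (q - 1) * (u powr (q - 1) - U powr (q - 1)) * G"
    using u by simp
  then have "u powr q * (V - H\<^sup>2 * P / (P * vol + G))
                    + q / (q - 1) * (lam powr (q - 1) - u powr (q - 1)) * G
    \<le> U powr q * (V - H\<^sup>2 * P / (P * vol + G))
                    + q / (q - 1) * (lam powr (q - 1) - U powr (q - 1)) * G"
    by (rule rearrange)
  then have "4 * q * K * (u powr q * (V - H\<^sup>2 * P / (P * vol + G))
                    + q / (q - 1) * (lam powr (q - 1) - u powr (q - 1)) * G)
    \<le> 4 * q * K * (U powr q * (V - H\<^sup>2 * P / (P * vol + G))
                    + q / (q - 1) * (lam powr (q - 1) - U powr (q - 1)) * G)"
    using assms by (intro mult_left_mono) auto
  then show ?thesis
    using u(1) unfolding bellman_def u_def[symmetric] by (simp add: max_def)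
qed (simp add: max_def)

lemma bellman_ge:
  fixes q K lam P U vol V G S H :: real
  assumes "1 < q" "0 \<le> K" "0 \<le> P" "0 \<le> U" "U \<le> lam" "0 < vol" "0 < V" "0 \<le> G" "0 \<le> S"
    and "H\<^sup>2 \<le> vol * V"
  shows "P powr q * S + G / lam \<le> bellman q K lam P U vol V G S H"
proof -
  have "U powr (q - 1) \<le> lam powr (q - 1)" using assms by (intro powr_mono2) auto
  then have "0 \<le> 4 * q * K * (U powr q * (V - H\<^sup>2 * P / (P * vol + G))
                    + q / (q - 1) * (lam powr (q - 1) - U powr (q - 1)) * G)"
    using assms weighted_square_le[of P vol V G H] by simp
  then show ?thesis by (simp add: bellman_def)
qed

text \<open>For fixed \<open>P\<close> and \<open>U\<close> every term is additive except the
  quotient, which is homogeneous of degree one and convex in \<open>(H, P vol + G)\<close> and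
  enters with a minus sign.\<close>

lemma bellman_superadditive:
  fixes vol V G S H :: "'i \<Rightarrow> real"
  assumes "1 < q" "0 \<le> K" "0 \<le> P" "0 \<le> U"
    and "\<And>i. i \<in> I \<Longrightarrow> 0 < vol i" "\<And>i. i \<in> I \<Longrightarrow> 0 \<le> G i"
  shows "(\<Sum>i\<in>I. bellman q K lam P U (vol i) (V i) (G i) (S i) (H i))
    \<le> bellman q K lam P U (sum vol I) (sum V I) (sum G I) (sum S I) (sum H I)"
proof -
  let ?X = "\<lambda>i. (H i)\<^sup>2 * P / (P * vol i + G i)"
  have "(sum H I)\<^sup>2 * P / (P * sum vol I + sum G I) \<le> sum ?X I"
  proof (cases "P = 0")
    case False
    have "(sum H I)\<^sup>2 / (\<Sum>i\<in>I. P * vol i + G i) \<le> (\<Sum>i\<in>I. (H i)\<^sup>2 / (P * vol i + G i))"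
      using assms False by (intro square_sum_div_le add_pos_nonneg) auto
    from mult_right_mono[OF this \<open>0 \<le> P\<close>] show ?thesis
      by (simp add: sum.distrib sum_distrib_left sum_distrib_right)
  qed simp
  then have "U powr q * (sum V I - sum ?X I)
      \<le> U powr q * (sum V I - (sum H I)\<^sup>2 * P / (P * sum vol I + sum G I))"
    by (intro mult_left_mono) auto
  then have "4 * q * K * (U powr q * (sum V I - sum ?X I)
       + q / (q - 1) * (lam powr (q - 1) - U powr (q - 1)) * sum G I)
      \<le> 4 * q * K * (U powr q * (sum V I - (sum H I)\<^sup>2 * P / (P * sum vol I + sum G I))
       + q / (q - 1) * (lam powr (q - 1) - U powr (q - 1)) * sum G I)"
    using assms by (intro mult_left_mono) auto
  moreover have "(\<Sum>i\<in>I. bellman q K lam P U (vol i) (V i) (G i) (S i) (H i))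
    = P powr q * sum S I
     + 4 * q * K * (U powr q * (sum V I - sum ?X I)
       + q / (q - 1) * (lam powr (q - 1) - U powr (q - 1)) * sum G I) + sum G I / lam"
    by (simp only: bellman_def sum.distrib sum_subtractf sum_distrib_left[symmetric]
        sum_divide_distrib[symmetric])
  ultimately show ?thesis by (simp add: bellman_def)
qed

text \<open>Here \<open>C Q\<close> is the set of children, and \<open>m N Q P\<close> stands for
  the \<open>v\<close>-mass of the points of \<open>Q\<close> at which \<open>v\<close> is below
  \<open>P\<close> or below an average of \<open>g\<close> over a cube of the next \<open>N\<close>
  generations. Only its recursion in \<open>N\<close> enters, so the induction is free of
  geometry.\<close>

lemma tree_bellman_bound:
  fixes C :: "'q \<Rightarrow> 'q set" and vol V G S H :: "'q \<Rightarrow> real"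
    and m :: "nat \<Rightarrow> 'q \<Rightarrow> real \<Rightarrow> real"
  assumes q: "1 < q" and K: "0 \<le> K" and lam: "0 < lam"
    and pos: "\<And>Q. 0 < vol Q" "\<And>Q. 0 < V Q" "\<And>Q. 0 \<le> G Q" "\<And>Q. 0 \<le> S Q"
    and add: "\<And>Q. vol Q = sum vol (C Q)" "\<And>Q. V Q = sum V (C Q)" "\<And>Q. G Q = sum G (C Q)"
      "\<And>Q. S Q = sum S (C Q)" "\<And>Q. H Q = sum H (C Q)"
    and CS: "\<And>Q. (H Q)\<^sup>2 \<le> vol Q * V Q"
    and key: "\<And>Q. (V Q / vol Q) powr q * S Q \<le> K * (H Q)\<^sup>2 / vol Q"
    and m_V: "\<And>N Q P. m N Q P \<le> V Q"
    and m_0: "\<And>Q P. 0 \<le> P \<Longrightarrow> m 0 Q P \<le> P powr q * S Q"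
    and m_Suc: "\<And>N Q P. m (Suc N) Q P \<le> (\<Sum>c\<in>C Q. m N c (max P (G c / vol c)))"
    and PU: "0 \<le> P" "0 \<le> U" "U \<le> lam"
  shows "m N Q P \<le> bellman q K lam P U (vol Q) (V Q) (G Q) (S Q) (H Q)"
  using PU
proof (induction N arbitrary: Q P U)
  case 0
  have "m 0 Q P \<le> P powr q * S Q + G Q / lam"
    using m_0[OF 0(1), of Q] pos(3)[of Q] lam by (simp add: add_increasing2)
  also have "\<dots> \<le> bellman q K lam P U (vol Q) (V Q) (G Q) (S Q) (H Q)"
    using 0 q K pos CS by (intro bellman_ge) auto
  finally show ?case .
next
  case (Suc N)
  let ?b = "\<lambda>P U Q. bellman q K lam P U (vol Q) (V Q) (G Q) (S Q) (H Q)"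
  have "m N c (max P (G c / vol c)) \<le> ?b P U c" for c
  proof (cases "G c / V c \<le> lam")
    case True
    have "m N c (max P (G c / vol c)) \<le> ?b (max P (G c / vol c)) (max U (G c / V c)) c"
      using True Suc by auto
    \<comment> \<open>The order matters: the level is undone while \<open>U\<close> is still raised,
      since \<open>bellman_max_level\<close> asks for \<open>G c / V c\<close> to be at most the
      current slope.\<close>
    also have "\<dots> \<le> ?b P (max U (G c / V c)) c"
      using Suc q K pos[of c] key by (intro bellman_max_level) auto
    also have "\<dots> \<le> ?b P U c"
      using Suc q K pos[of c] by (intro bellman_max_slope) auto
    finally show ?thesis .
  next
    case False
    \<comment> \<open>Stopping: on a child with slope above \<open>lam\<close> no descent is made,
      because its whole mass fits into the last term of \<open>bellman\<close>.\<close>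
    then have "V c \<le> G c / lam" using lam pos(2)[of c] by (simp add: field_simps)
    also have "\<dots> \<le> P powr q * S c + G c / lam" using pos(4)[of c] by simp
    also have "\<dots> \<le> ?b P U c"
      using Suc q K pos CS by (intro bellman_ge) auto
    finally show ?thesis using m_V[of N c] by (rule order_trans[rotated])
  qed
  then have "m (Suc N) Q P \<le> (\<Sum>c\<in>C Q. ?b P U c)"
    by (intro order_trans[OF m_Suc] sum_mono)
  also have "\<dots> \<le> ?b P U Q"
    unfolding add[of Q] using Suc q K pos by (intro bellman_superadditive) auto
  finally show ?case .
qed

lemma tree_weak_bound:
  fixes C :: "'q \<Rightarrow> 'q set" and vol V G S H :: "'q \<Rightarrow> real"
    and m :: "nat \<Rightarrow> 'q \<Rightarrow> real \<Rightarrow> real"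
  assumes q: "1 < q" and B: "0 < B"
    and pos: "\<And>Q. 0 < vol Q" "\<And>Q. 0 < V Q" "\<And>Q. 0 \<le> G Q" "\<And>Q. 0 \<le> S Q"
    and add: "\<And>Q. vol Q = sum vol (C Q)" "\<And>Q. V Q = sum V (C Q)" "\<And>Q. G Q = sum G (C Q)"
      "\<And>Q. S Q = sum S (C Q)" "\<And>Q. H Q = sum H (C Q)"
    and CS: "\<And>Q. (H Q)\<^sup>2 \<le> vol Q * V Q"
    and key: "\<And>Q. (V Q / vol Q) powr q * S Q \<le> B powr q * (H Q)\<^sup>2 / vol Q"
    and m_V: "\<And>N Q P. m N Q P \<le> V Q"
    and m_0: "\<And>Q P. 0 \<le> P \<Longrightarrow> m 0 Q P \<le> P powr q * S Q"
    and m_Suc: "\<And>N Q P. m (Suc N) Q P \<le> (\<Sum>c\<in>C Q. m N c (max P (G c / vol c)))"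
  shows "m N Q 0 \<le> (4 * (q / (q - 1)) + 3) * B * G Q"
proof -
  define lam where "lam = 1 / (exp 1 * B)"
  have lam: "0 < lam" using B by (simp add: lam_def)
  have "m N Q 0 \<le> bellman q (B powr q) lam 0 0 (vol Q) (V Q) (G Q) (S Q) (H Q)"
    by (rule tree_bellman_bound[where C = C and m = m, OF q _ lam pos add CS key m_V m_0 m_Suc])
      (use lam in auto)
  \<comment> \<open>With \<open>0 powr q = 0\<close> and \<open>0 powr (q - 1) = 0\<close> the terms
    in \<open>S\<close>, \<open>V\<close> and \<open>H\<close> vanish, which leaves a bound by
    \<open>G\<close> alone.\<close>
  also have "\<dots> = (4 * (q / (q - 1)) * (q * B powr q * lam powr (q - 1)) + 1 / lam) * G Q"
    using q by (simp add: bellman_def algebra_simps)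
  also have "q * B powr q * lam powr (q - 1) = q * exp (1 - q) * B"
  proof -
    have "lam powr (q - 1) = exp (1 - q) * exp ((1 - q) * ln B)"
      using B by (simp add: lam_def powr_def ln_div ln_mult flip: exp_add) (simp add: algebra_simps)
    moreover have "B powr q * exp ((1 - q) * ln B) = B"
      using B by (simp add: powr_def algebra_simps flip: exp_add)
    ultimately show ?thesis by (simp add: algebra_simps)
  qed
  also have "(4 * (q / (q - 1)) * (q * exp (1 - q) * B) + 1 / lam) * G Q
      \<le> (4 * (q / (q - 1)) * (1 * B) + 3 * B) * G Q"
  proof (intro mult_right_mono add_mono mult_left_mono)
    have "q \<le> exp (q - 1)" using exp_ge_add_one_self[of "q - 1"] by simp
    then show "q * exp (1 - q) \<le> 1" by (simp add: exp_diff field_simps)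
    show "1 / lam \<le> 3 * B" using exp_le B by (simp add: lam_def)
  qed (use q B pos in auto)
  finally show ?thesis by (simp add: algebra_simps)
qed

section \<open>Dyadic cubes\<close>

definition dyadic_cube :: "int \<Rightarrow> int ^ 'n \<Rightarrow> (real ^ 'n) set" where
  "dyadic_cube k j =
     {x. \<forall>i. 2 powi k * of_int (j $ i) \<le> x $ i \<and> x $ i < 2 powi k * (of_int (j $ i) + 1)}"

text \<open>The cubes of side \<open>2 powi k\<close> are the fibres of this map, so that
  disjointness and covering become facts about a function.\<close>

definition dyadic_index :: "int \<Rightarrow> real ^ 'n \<Rightarrow> int ^ 'n" where
  "dyadic_index k x = (\<chi> i. \<lfloor>x $ i / 2 powi k\<rfloor>)"

text \<open>Indices one level down, at side \<open>2 powi (k - 1)\<close>. Integer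
  \<open>div\<close> rounds down, so negative indices are treated correctly too.\<close>

definition dyadic_children :: "int ^ 'n \<Rightarrow> (int ^ 'n) set" where
  "dyadic_children j = {c. \<forall>i. c $ i div 2 = j $ i}"

lemma dyadic_cubes_eq: "dyadic_cubes = (\<lambda>(k, j). dyadic_cube k j) ` UNIV"
  by (auto simp: dyadic_cubes_def dyadic_cube_def image_iff)

lemma mem_dyadic_cube_iff: "x \<in> dyadic_cube k j \<longleftrightarrow> dyadic_index k x = j"
proof -
  have "2 powi k * of_int m \<le> y \<and> y < 2 powi k * (of_int m + 1) \<longleftrightarrow> \<lfloor>y / 2 powi k\<rfloor> = m"
    for y :: real and m :: int
    by (simp add: floor_eq_iff field_simps)
  then show ?thesis by (simp add: dyadic_cube_def dyadic_index_def vec_eq_iff)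
qed

lemma dyadic_index_div: "dyadic_index k x $ i = dyadic_index (k - 1) x $ i div 2"
proof -
  have "x $ i / 2 powi k = (x $ i / 2 powi (k - 1)) / of_int 2"
    by (simp add: power_int_diff)
  then show ?thesis
    unfolding dyadic_index_def by (simp only: vec_lambda_beta floor_divide_real_eq_div)
qed

lemma dyadic_cube_eq_Union_children:
  "dyadic_cube k j = (\<Union>c\<in>dyadic_children j. dyadic_cube (k - 1) c)"
  by (auto simp: mem_dyadic_cube_iff dyadic_children_def vec_eq_iff[of _ j] dyadic_index_div[of k])

lemma finite_dyadic_children: "finite (dyadic_children j)"
proof (rule finite_subset)
  show "dyadic_children j \<subseteq> vec_lambda ` (PiE UNIV (\<lambda>i. {2 * j $ i, 2 * j $ i + 1}))"
  proof
    fix c assume c: "c \<in> dyadic_children j"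
    have "c $ i = 2 * j $ i \<or> c $ i = 2 * j $ i + 1" for i
      using c mod_mult_div_eq[of "c $ i" 2] unfolding dyadic_children_def by (auto; presburger)
    then show "c \<in> vec_lambda ` (PiE UNIV (\<lambda>i. {2 * j $ i, 2 * j $ i + 1}))"
      by (intro image_eqI[of _ _ "vec_nth c"]) auto
  qed
qed (auto intro!: finite_PiE)

lemma disjoint_dyadic_cubes: "disjoint_family_on (dyadic_cube k) I"
  by (auto simp: disjoint_family_on_def mem_dyadic_cube_iff)

lemma borel_dyadic_cube: "dyadic_cube k j \<in> sets borel"
proof -
  have "dyadic_cube k j = (\<Inter>i. {x. 2 powi k * of_int (j $ i) \<le> x $ i} \<inter>
      {x. x $ i < 2 powi k * (of_int (j $ i) + 1)})"
    by (auto simp: dyadic_cube_def)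
  also have "\<dots> \<in> sets borel"
    by (intro sets.countable_INT' sets.Int borel_closed borel_open)
      (auto intro!: closed_Collect_le open_Collect_less continuous_intros)
  finally show ?thesis .
qed

text \<open>The constants are suprema over closed cubes, whereas dyadic cubes are half-open; they
  differ by faces, which are null.\<close>

lemma dyadic_cube_AE_eq_cube:
  fixes j :: "int ^ 'n"
  obtains Q where "Q \<in> cubes" "AE x in lebesgue. x \<in> dyadic_cube k j \<longleftrightarrow> x \<in> Q"
proof -
  define a :: "real ^ 'n" where "a = (\<chi> i. 2 powi k * of_int (j $ i))"
  define b :: "real ^ 'n" where "b = a + (\<chi> i. 2 powi k)"
  have "box a b \<subseteq> dyadic_cube k j" "dyadic_cube k j \<subseteq> cbox a b"
    by (auto simp: mem_box_cart dyadic_cube_def a_def b_def algebra_simps less_imp_le)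
  moreover have "AE x in lebesgue. x \<notin> frontier (cbox a b)"
    using negligible_frontier_interval[of a b]
    by (intro AE_not_in) (auto simp: negligible_iff_null_sets frontier_cbox)
  ultimately have "AE x in lebesgue. x \<in> dyadic_cube k j \<longleftrightarrow> x \<in> cbox a b"
    by (auto simp: frontier_cbox)
  moreover have "cbox a b \<in> cubes" by (force simp: cubes_def b_def)
  ultimately show ?thesis by (rule that[rotated])
qed

lemma cbox_cube_measure:
  assumes "Q \<in> cubes"
  shows "Q \<in> lmeasurable" "0 < measure lebesgue Q"
  using assms by (auto simp: cubes_def content_cbox_if_cart interval_eq_empty_cart intro!: prod_pos)

lemma AE_eq_measure:
  assumes "AE x in lebesgue. x \<in> D \<longleftrightarrow> x \<in> Q" "D \<in> sets lebesgue" "Q \<in> lmeasurable"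
  shows "D \<in> lmeasurable" "measure lebesgue D = measure lebesgue Q"
proof -
  have "emeasure lebesgue D = emeasure lebesgue Q"
    using assms by (intro emeasure_eq_AE) auto
  with assms show "D \<in> lmeasurable" "measure lebesgue D = measure lebesgue Q"
    by (auto simp: fmeasurable_def measure_def)
qed

lemma dyadic_cube_measure:
  shows "dyadic_cube k j \<in> sets lebesgue" "dyadic_cube k j \<in> lmeasurable"
    "0 < measure lebesgue (dyadic_cube k j)"
proof -
  obtain Q where Q: "Q \<in> cubes" "AE x in lebesgue. x \<in> dyadic_cube k j \<longleftrightarrow> x \<in> Q"
    by (rule dyadic_cube_AE_eq_cube)
  show s: "dyadic_cube k j \<in> sets lebesgue" by (rule sets_completionI_sets) (simp add: borel_dyadic_cube)
  show "dyadic_cube k j \<in> lmeasurable" "0 < measure lebesgue (dyadic_cube k j)"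
    using AE_eq_measure[OF Q(2) s] cbox_cube_measure[OF Q(1)] by auto
qed

lemma dyadic_cube_subset_cbox:
  fixes j :: "int ^ 'n"
  obtains n where "dyadic_cube k j \<subseteq> cbox (\<chi> i. - real n) (\<chi> i. real n)"
proof -
  define R where "R = (\<Sum>i\<in>UNIV. 2 powi k * (\<bar>of_int (j $ i)\<bar> + 1 :: real))"
  obtain n where n: "R \<le> real n" using real_arch_simple by blast
  have "- real n \<le> x $ i \<and> x $ i \<le> real n" if "x \<in> dyadic_cube k j" for x i
  proof -
    have "2 powi k * of_int (j $ i) \<le> x $ i" "x $ i < 2 powi k * (of_int (j $ i) + 1)"
      using that by (auto simp: dyadic_cube_def)
    moreover have "2 powi k * (of_int (j $ i) + 1 :: real) \<le> 2 powi k * (\<bar>of_int (j $ i)\<bar> + 1)"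
      "- (2 powi k * (\<bar>of_int (j $ i)\<bar> + 1 :: real)) \<le> 2 powi k * of_int (j $ i)"
      unfolding mult_minus_right[symmetric] by (intro mult_left_mono; simp)+
    ultimately have "\<bar>x $ i\<bar> \<le> 2 powi k * (\<bar>of_int (j $ i)\<bar> + 1)" unfolding abs_le_iff by linarith
    also have "\<dots> \<le> R" unfolding R_def by (intro member_le_sum) auto
    finally show ?thesis using n by linarith
  qed
  then show ?thesis by (intro that[of n]) (auto simp: mem_box_cart)
qed

lemma set_integral_dyadic_children:
  fixes f :: "real ^ 'n \<Rightarrow> real"
  assumes "set_integrable lebesgue (dyadic_cube k j) f"
  shows "(LINT x:dyadic_cube k j|lebesgue. f x) =
    (\<Sum>c\<in>dyadic_children j. LINT x:dyadic_cube (k - 1) c|lebesgue. f x)"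
  unfolding dyadic_cube_eq_Union_children[of k j]
proof (rule set_integral_finite_Union)
  show "set_integrable lebesgue (dyadic_cube (k - 1) c) f" if "c \<in> dyadic_children j" for c
    using that assms dyadic_cube_eq_Union_children[of k j] dyadic_cube_measure(1)[of "k - 1" c]
    by (auto intro: set_integrable_subset)
qed (auto simp: finite_dyadic_children disjoint_dyadic_cubes dyadic_cube_measure(1))

section \<open>Averages and Muckenhoupt constants\<close>

text \<open>Integrability is assumed on compact sets only, so \<open>v\<close> is recovered as the
  pointwise limit of its truncations to balls.\<close>

lemma borel_measurable_weight:
  fixes v :: "real ^ 'n \<Rightarrow> real"
  assumes "weight v"
  shows "v \<in> borel_measurable lebesgue"
proof (rule borel_measurable_LIMSEQ_real)
  show "(\<lambda>x. indicator (cball 0 (real n)) x *\<^sub>R v x) \<in> borel_measurable lebesgue" for n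
    using assms by (auto simp: weight_def set_integrable_def intro: borel_measurable_integrable)
  show "(\<lambda>n. indicator (cball 0 (real n)) x *\<^sub>R v x) \<longlonglongrightarrow> v x" for x
  proof (rule tendsto_eventually)
    obtain n0 where "norm x \<le> real n0" using real_arch_simple by blast
    then have "\<forall>n\<ge>n0. indicator (cball 0 (real n)) x *\<^sub>R v x = v x"
      by (auto simp: indicator_def)
    then show "\<forall>\<^sub>F n in sequentially. indicator (cball 0 (real n)) x *\<^sub>R v x = v x"
      by (auto simp: eventually_sequentially)
  qed
qed

lemma weight_integrable_dyadic_cube:
  fixes v :: "real ^ 'n \<Rightarrow> real"
  assumes "weight v"
  shows "set_integrable lebesgue (dyadic_cube k j) v"
proof -
  obtain n where n: "dyadic_cube k j \<subseteq> cbox (\<chi> i. - real n) (\<chi> i. real n)"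
    by (rule dyadic_cube_subset_cbox)
  have "set_integrable lebesgue (cbox (\<chi> i. - real n) (\<chi> i. real n)) v"
    using assms by (simp add: weight_def)
  then show ?thesis
    using n by (rule set_integrable_subset[OF _ dyadic_cube_measure(1)])
qed

section \<open>Averages and constants up to null sets\<close>

lemma avg_cong_AE:
  assumes "AE x in lebesgue. x \<in> Q \<longrightarrow> f x = g x"
  shows "avg Q f = avg Q g"
proof -
  have "(\<integral>\<^sup>+x\<in>Q. f x \<partial>lebesgue) = (\<integral>\<^sup>+x\<in>Q. g x \<partial>lebesgue)"
    using assms by (intro nn_integral_cong_AE) (auto simp: indicator_def)
  then show ?thesis by (simp add: avg_def)
qed

lemma avg_cong_set:
  assumes "AE x in lebesgue. x \<in> D \<longleftrightarrow> x \<in> Q" "D \<in> sets lebesgue" "Q \<in> sets lebesgue"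
  shows "avg D f = avg Q f"
proof -
  have "(\<integral>\<^sup>+x\<in>D. f x \<partial>lebesgue) = (\<integral>\<^sup>+x\<in>Q. f x \<partial>lebesgue)"
    using assms by (intro nn_integral_cong_AE) (auto simp: indicator_def)
  moreover have "emeasure lebesgue D = emeasure lebesgue Q"
    using assms by (intro emeasure_eq_AE) auto
  ultimately show ?thesis by (simp add: avg_def)
qed

lemma ess_inf_on_cong_set:
  assumes "AE x in lebesgue. x \<in> D \<longleftrightarrow> x \<in> Q"
  shows "ess_inf_on D f = ess_inf_on Q f"
proof -
  have "(AE x in lebesgue. x \<in> D \<longrightarrow> z \<le> f x) \<longleftrightarrow> (AE x in lebesgue. x \<in> Q \<longrightarrow> z \<le> f x)" for z
    by (intro iffI; rule AE_mp[OF assms]) auto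
  then show ?thesis by (simp add: ess_inf_on_def)
qed

lemma mixed_const_ge_dyadic:
  "epowr (Ap_on p v (dyadic_cube k j)) \<alpha> * epowr (Ainf_exp_on v (dyadic_cube k j)) \<beta>
     \<le> mixed_const p \<alpha> \<beta> v"
proof -
  obtain Q where Q: "Q \<in> cubes" "AE x in lebesgue. x \<in> dyadic_cube k j \<longleftrightarrow> x \<in> Q"
    by (rule dyadic_cube_AE_eq_cube)
  have "Q \<in> sets lebesgue" using cbox_cube_measure(1)[OF Q(1)] by auto
  then have "avg (dyadic_cube k j) f = avg Q f" for f
    by (intro avg_cong_set Q dyadic_cube_measure)
  then have "Ap_on p v (dyadic_cube k j) = Ap_on p v Q"
    "Ainf_exp_on v (dyadic_cube k j) = Ainf_exp_on v Q"
    by (simp_all add: Ap_on_def Ainf_exp_on_def signed_avg_def ess_inf_on_cong_set[OF Q(2)])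
  then show ?thesis unfolding mixed_const_def using Q(1) by (auto intro: SUP_upper)
qed

lemma set_integral_nonneg:
  fixes f :: "'a \<Rightarrow> real"
  assumes "\<And>x. 0 \<le> f x"
  shows "0 \<le> (LINT x:Q|M. f x)"
  using assms unfolding set_lebesgue_integral_def by (intro integral_nonneg_AE) auto

lemma nn_set_integral_eq:
  fixes f :: "'a \<Rightarrow> real"
  assumes "set_integrable M Q f" "\<And>x. 0 \<le> f x"
  shows "(\<integral>\<^sup>+x\<in>Q. ennreal (f x) \<partial>M) = ennreal (LINT x:Q|M. f x)"
proof -
  have "(\<integral>\<^sup>+x\<in>Q. ennreal (f x) \<partial>M) = (\<integral>\<^sup>+x. ennreal (indicator Q x *\<^sub>R f x) \<partial>M)"
    by (intro nn_integral_cong) (auto simp: indicator_def)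
  also have "\<dots> = ennreal (LINT x:Q|M. f x)"
    using assms unfolding set_integrable_def set_lebesgue_integral_def
    by (intro nn_integral_eq_integral) (auto simp: indicator_def)
  finally show ?thesis .
qed

lemma avg_eq_integral:
  fixes f :: "real ^ 'n \<Rightarrow> real"
  assumes "set_integrable lebesgue Q f" "\<And>x. 0 \<le> f x" "Q \<in> lmeasurable" "0 < measure lebesgue Q"
  shows "avg Q (\<lambda>x. ennreal (f x)) = ennreal ((LINT x:Q|lebesgue. f x) / measure lebesgue Q)"
proof -
  have "0 \<le> (LINT x:Q|lebesgue. f x)"
    using assms(2) by (rule set_integral_nonneg)
  then show ?thesis
    using assms unfolding avg_def nn_set_integral_eq[OF assms(1,2)]
    by (simp add: emeasure_eq_measure2 divide_ennreal)
qed

lemma epowr_ennreal: "0 < x \<Longrightarrow> epowr (ennreal x) a = ennreal (x powr a)"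
  by (simp add: epowr_def)

lemma epowr_mult_le_imp:
  assumes "epowr (ennreal x) a * epowr (ennreal y) b \<le> ennreal B" "0 < x" "0 < y" "0 \<le> B"
  shows "x powr a * y powr b \<le> B"
  using assms by (simp add: epowr_ennreal flip: ennreal_mult)

lemma epowr_mono:
  assumes "x \<le> y" "0 \<le> a"
  shows "epowr x a \<le> epowr y a"
proof (cases "a = 0 \<or> x = 0 \<or> y = top")
  case False
  then have "x < top" "y \<noteq> 0" using assms by (auto simp: less_top top_unique)
  then show ?thesis using False assms
    by (auto simp: epowr_def less_top intro!: ennreal_leI powr_mono2 enn2real_mono)
qed (use assms in \<open>auto simp: epowr_def top_unique\<close>)

section \<open>The square root of the weight\<close>

lemma set_integrable_sqrt:
  fixes v :: "'a \<Rightarrow> real"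
  assumes v: "set_integrable M Q v" "v \<in> borel_measurable M" "\<And>x. 0 \<le> v x"
    and Q: "Q \<in> fmeasurable M"
  shows "set_integrable M Q (\<lambda>x. sqrt (v x))"
proof (rule set_integrable_bound)
  show "set_integrable M Q (\<lambda>x. 1 + v x)"
    using v Q by (intro set_integral_add) (auto simp: set_integrable_def fmeasurable_def)
  show "set_borel_measurable M Q (\<lambda>x. sqrt (v x))"
    using v Q unfolding set_borel_measurable_def by measurable
  have "sqrt y \<le> 1 + y" if "0 \<le> y" for y :: real
    using that by (intro real_le_lsqrt) (auto simp: power2_eq_square algebra_simps)
  then show "AE x in M. x \<in> Q \<longrightarrow> norm (sqrt (v x)) \<le> norm (1 + v x)"
    using v by (auto simp: abs_of_nonneg)
qed

text \<open>Integrate \<open>0 <= (sqrt v - t)^2\<close> with \<open>t\<close> the average of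
  \<open>sqrt v\<close>; this is \<open>h_Q^2 <= v_Q\<close>.\<close>

lemma set_integral_sqrt_square_le:
  fixes v :: "'a \<Rightarrow> real"
  assumes v: "set_integrable M Q v" "v \<in> borel_measurable M" "\<And>x. 0 \<le> v x"
    and Q: "Q \<in> fmeasurable M" "0 < measure M Q"
  shows "(LINT x:Q|M. sqrt (v x))\<^sup>2 \<le> measure M Q * (LINT x:Q|M. v x)"
proof -
  define t where "t = (LINT x:Q|M. sqrt (v x)) / measure M Q"
  note I = set_integrable_sqrt[OF v Q(1)]
  have one: "set_integrable M Q (\<lambda>x. c :: real)" for c
    using Q by (auto simp: set_integrable_def fmeasurable_def)
  have "(LINT x:Q|M. 2 * t * sqrt (v x) - t\<^sup>2) \<le> (LINT x:Q|M. v x)"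
  proof (rule set_integral_mono)
    show "set_integrable M Q (\<lambda>x. 2 * t * sqrt (v x) - t\<^sup>2)" using I one by auto
    show "2 * t * sqrt (v x) - t\<^sup>2 \<le> v x" for x
      using zero_le_power2[of "sqrt (v x) - t"] v(3)[of x] by (simp add: power2_diff algebra_simps)
  qed (fact v)
  also have "(LINT x:Q|M. 2 * t * sqrt (v x) - t\<^sup>2) = 2 * t * (LINT x:Q|M. sqrt (v x)) - t\<^sup>2 * measure M Q"
    using I one Q by (simp add: set_integral_diff set_integral_const fmeasurable_def less_top)
  also have "\<dots> = (LINT x:Q|M. sqrt (v x))\<^sup>2 / measure M Q"
    using Q by (simp add: t_def power2_eq_square field_simps)
  finally show ?thesis using Q by (simp add: field_simps)
qed

section \<open>Jensen's inequality and the case \<open>p > 1\<close>\<close>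

lemma not_AE_notin:
  assumes "Q \<in> lmeasurable" "0 < measure lebesgue Q"
  shows "\<not> (AE x in lebesgue. x \<notin> Q)"
proof
  assume "AE x in lebesgue. x \<notin> Q"
  then have "emeasure lebesgue Q = 0"
    using assms(1) by (subst (asm) AE_iff_measurable[of Q]) auto
  with assms(2) show False by (simp add: measure_def)
qed

lemma set_integral_pos:
  fixes f :: "real ^ 'n \<Rightarrow> real"
  assumes "set_integrable lebesgue Q f" "Q \<in> lmeasurable" "0 < measure lebesgue Q"
    and "\<And>x. 0 \<le> f x" "AE x in lebesgue. x \<in> Q \<longrightarrow> 0 < f x"
  shows "0 < (LINT x:Q|lebesgue. f x)"
proof (rule ccontr)
  assume "\<not> 0 < (LINT x:Q|lebesgue. f x)"
  moreover have "0 \<le> (LINT x:Q|lebesgue. f x)"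
    using assms(4) by (rule set_integral_nonneg)
  ultimately have "(LINT x:Q|lebesgue. f x) = 0" by simp
  then have "AE x in lebesgue. indicator Q x *\<^sub>R f x = 0"
    using assms unfolding set_lebesgue_integral_def set_integrable_def
    by (subst (asm) integral_nonneg_eq_0_iff_AE) auto
  with assms(5) have "AE x in lebesgue. x \<notin> Q" by eventually_elim (auto simp: indicator_def)
  with not_AE_notin[OF assms(2,3)] show False by blast
qed

text \<open>Apply \<open>ln z <= z - 1\<close> to \<open>z = y\<close> and to
  \<open>z = y powr (1 - q)\<close>. The bound makes \<open>log v\<close> integrable as soon as
  \<open>v\<close> and its dual weight are.\<close>

lemma abs_ln_inverse_le:
  fixes y q :: real
  assumes "0 < y" "1 < q"
  shows "\<bar>ln (1 / y)\<bar> \<le> y + y powr (1 - q) / (q - 1)"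
proof -
  have "ln y \<le> y" using ln_le_minus_one[OF assms(1)] by simp
  moreover have "(q - 1) * ln (1 / y) \<le> y powr (1 - q)"
    using ln_le_minus_one[of "y powr (1 - q)"] assms by (simp add: ln_powr ln_div algebra_simps)
  then have "ln (1 / y) \<le> y powr (1 - q) / (q - 1)" using assms by (simp add: field_simps)
  moreover have "0 \<le> y powr (1 - q) / (q - 1)" using assms by simp
  moreover have "ln (1 / y) = - ln y" using assms by (simp add: ln_div)
  ultimately show ?thesis using assms unfolding abs_le_iff by linarith
qed

text \<open>Jensen's inequality for \<open>2 * ln (1 / s)\<close>, a convex function of
  \<open>s = sqrt (v x)\<close>; the square of the reciprocal mean of \<open>sqrt v\<close> comes
  from the factor \<open>2\<close>.\<close>

lemma Ainf_exp_on_ge: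
  fixes v :: "real ^ 'n \<Rightarrow> real"
  assumes Q: "Q \<in> lmeasurable" "0 < measure lebesgue Q"
    and v: "set_integrable lebesgue Q v" "v \<in> borel_measurable lebesgue" "\<And>x. 0 \<le> v x"
      "AE x in lebesgue. x \<in> Q \<longrightarrow> 0 < v x"
    and q: "1 < q" "set_integrable lebesgue Q (\<lambda>x. v x powr (1 - q))"
  shows "ennreal ((LINT x:Q|lebesgue. v x) / measure lebesgue Q *
      (measure lebesgue Q / (LINT x:Q|lebesgue. sqrt (v x)))\<^sup>2) \<le> Ainf_exp_on v Q"
proof -
  define r where "r = (\<lambda>x. ln (1 / v x))"
  define th where "th = (LINT x:Q|lebesgue. sqrt (v x)) / measure lebesgue Q"
  let ?A = "measure lebesgue Q"
  note I = set_integrable_sqrt[OF v(1,2,3) Q(1)]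
  have one: "set_integrable lebesgue Q (\<lambda>x. c :: real)" for c
    using Q by (auto simp: set_integrable_def fmeasurable_def)
  have const: "(LINT x:Q|lebesgue. c) = c * ?A" for c :: real
    using set_integral_const[of Q lebesgue c] Q by (auto simp: fmeasurable_def)
  have "0 < (LINT x:Q|lebesgue. sqrt (v x))"
    using I Q v by (intro set_integral_pos) auto
  then have th: "0 < th" using Q by (simp add: th_def)
  have Qs: "Q \<in> sets lebesgue" using Q by auto
  have r: "set_integrable lebesgue Q r"
  proof (rule set_integrable_bound)
    show "set_integrable lebesgue Q (\<lambda>x. v x + v x powr (1 - q) / (q - 1))"
      using v q by auto
    show "set_borel_measurable lebesgue Q r"
      using v(2) Qs unfolding set_borel_measurable_def r_def by measurable
    show "AE x in lebesgue. x \<in> Q \<longrightarrow> norm (r x) \<le> norm (v x + v x powr (1 - q) / (q - 1))"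
      using v(4)
    proof eventually_elim
      case (elim x)
      then show ?case using abs_ln_inverse_le[of "v x" q] q by (auto simp: r_def)
    qed
  qed
  \<comment> \<open>Since \<open>signed_avg\<close> averages the positive and the negative part
    separately, each must be integrable before they recombine into the integral of
    \<open>r\<close>.\<close>
  then have r': "set_integrable lebesgue Q (\<lambda>x. max 0 (r x))" "set_integrable lebesgue Q (\<lambda>x. max 0 (- r x))"
  proof -
    have "(\<lambda>x. max 0 (r x)) = (\<lambda>x. (\<bar>r x\<bar> + r x) / 2)"
      "(\<lambda>x. max 0 (- r x)) = (\<lambda>x. (\<bar>r x\<bar> - r x) / 2)"
      by (auto simp: max_def)
    then show "set_integrable lebesgue Q (\<lambda>x. max 0 (r x))"
      "set_integrable lebesgue Q (\<lambda>x. max 0 (- r x))"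
      using r set_integrable_abs[OF r] by simp_all
  qed
  have "ennreal (max 0 t) = ennreal t" for t
    by (cases "0 \<le> t") (auto simp: max_def ennreal_neg)
  then have "avg Q (\<lambda>x. e2ennreal (ln_inverse (v x))) = avg Q (\<lambda>x. ennreal (max 0 (r x)))"
    "avg Q (\<lambda>x. e2ennreal (- ln_inverse (v x))) = avg Q (\<lambda>x. ennreal (max 0 (- r x)))"
    using v(4) by (auto intro!: avg_cong_AE elim!: eventually_mono simp: ln_inverse_def r_def)
  then have "signed_avg Q (\<lambda>x. ln_inverse (v x)) =
      ereal (((LINT x:Q|lebesgue. max 0 (r x)) - (LINT x:Q|lebesgue. max 0 (- r x))) / ?A)"
    using r' Q by (simp add: signed_avg_def avg_eq_integral enn2ereal_ennreal diff_divide_distrib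
        set_integral_nonneg)
  also have "(LINT x:Q|lebesgue. max 0 (r x)) - (LINT x:Q|lebesgue. max 0 (- r x)) =
      (LINT x:Q|lebesgue. max 0 (r x) - max 0 (- r x))"
    using r' by simp
  also have "(\<lambda>x. max 0 (r x) - max 0 (- r x)) = r" by auto
  finally have sa: "signed_avg Q (\<lambda>x. ln_inverse (v x)) = ereal ((LINT x:Q|lebesgue. r x) / ?A)" .
  \<comment> \<open>The integrand is the tangent to \<open>2 * ln (1 / s)\<close> at
    \<open>s = th\<close>; as \<open>th\<close> is the mean of \<open>sqrt v\<close>, its
    non-constant part integrates to zero.\<close>
  have "(LINT x:Q|lebesgue. 2 * ln (1 / th) + 2 * (1 - sqrt (v x) / th)) \<le> (LINT x:Q|lebesgue. r x)"
  proof (rule set_integral_mono_AE)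
    show "set_integrable lebesgue Q (\<lambda>x. 2 * ln (1 / th) + 2 * (1 - sqrt (v x) / th))"
      using I one by auto
    show "AE x\<in>Q in lebesgue. 2 * ln (1 / th) + 2 * (1 - sqrt (v x) / th) \<le> r x"
      using v(4)
    proof eventually_elim
      case (elim x)
      show ?case
      proof
        assume "x \<in> Q"
        with elim have "0 < v x" by auto
        then show "2 * ln (1 / th) + 2 * (1 - sqrt (v x) / th) \<le> r x"
          using ln_le_minus_one[of "sqrt (v x) / th"] th by (simp add: r_def ln_div ln_sqrt)
      qed
    qed
  qed (fact r)
  also have "(LINT x:Q|lebesgue. 2 * ln (1 / th) + 2 * (1 - sqrt (v x) / th))
     = 2 * ln (1 / th) * ?A + 2 * (?A - (LINT x:Q|lebesgue. sqrt (v x)) / th)"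
    using I one const by (simp add: algebra_simps)
  also have "(LINT x:Q|lebesgue. sqrt (v x)) / th = ?A" using th Q by (auto simp: th_def)
  finally have "2 * ln (1 / th) \<le> (LINT x:Q|lebesgue. r x) / ?A"
    using Q by (simp add: field_simps)
  then have "exp (2 * ln (1 / th)) \<le> exp ((LINT x:Q|lebesgue. r x) / ?A)" by simp
  also have "exp (2 * ln (1 / th)) = (1 / th)\<^sup>2"
    unfolding exp_double using th by (subst exp_ln) auto
  finally have "(?A / (LINT x:Q|lebesgue. sqrt (v x)))\<^sup>2 \<le> exp ((LINT x:Q|lebesgue. r x) / ?A)"
    by (simp add: th_def)
  moreover have "0 \<le> (LINT x:Q|lebesgue. v x)"
    using v(3) by (rule set_integral_nonneg)
  ultimately show ?thesis
    using Q v by (simp add: Ainf_exp_on_def sa exp_ereal_def avg_eq_integral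
      mult_left_mono divide_right_mono flip: ennreal_mult')
qed

text \<open>To be read with \<open>x = v_Q\<close>, \<open>s = sigma_Q\<close> and
  \<open>z = h_Q^(-2)\<close>: the exponents \<open>1/p\<close> and \<open>1/q\<close> of the mixed
  constant are such that the \<open>q\<close>-th power leaves both \<open>s\<close> and
  \<open>z\<close> to the power one.\<close>

lemma powr_mixed_identity:
  fixes x s z p q :: real
  assumes "0 < x" "0 < s" "0 < z" "1 < p" "1 < q" "q * (p - 1) = p"
  shows "((x * s powr (p - 1)) powr (1 / p) * (x * z) powr (1 / q)) powr q = x powr (q / p + 1) * s * z"
proof -
  have "((p - 1) * (1 / p)) * q = 1" "(1 / p) * q = q / p" "(1 / q) * q = 1"
    using assms by (auto simp: field_simps)
  moreover have "((x * s powr (p - 1)) powr (1 / p) * (x * z) powr (1 / q)) powr q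
     = (x powr ((1 / p) * q) * s powr (((p - 1) * (1 / p)) * q)) * (x powr ((1 / q) * q) * z powr ((1 / q) * q))"
    using assms by (simp only: powr_mult powr_powr mult_nonneg_nonneg powr_ge_zero less_imp_le)
  ultimately show ?thesis using assms by (simp add: powr_add)
qed

lemma key_bound_Ap:
  fixes v :: "real ^ 'n \<Rightarrow> real"
  assumes Q: "Q \<in> lmeasurable" "0 < measure lebesgue Q"
    and v: "set_integrable lebesgue Q v" "v \<in> borel_measurable lebesgue" "\<And>x. 0 \<le> v x"
      "AE x in lebesgue. x \<in> Q \<longrightarrow> 0 < v x"
    and p: "1 < p" "set_integrable lebesgue Q (\<lambda>x. v x powr (1 - conj_exp p))"
    and B: "epowr (Ap_on p v Q) (1 / p) * epowr (Ainf_exp_on v Q) (1 / conj_exp p) \<le> ennreal B" "0 \<le> B"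
  shows "((LINT x:Q|lebesgue. v x) / measure lebesgue Q) powr conj_exp p *
      (LINT x:Q|lebesgue. v x powr (1 - conj_exp p))
    \<le> B powr conj_exp p * (LINT x:Q|lebesgue. sqrt (v x))\<^sup>2 / measure lebesgue Q"
proof -
  define A V H S where "A = measure lebesgue Q" and "V = (LINT x:Q|lebesgue. v x)"
    and "H = (LINT x:Q|lebesgue. sqrt (v x))"
    and "S = (LINT x:Q|lebesgue. v x powr (1 - conj_exp p))"
  define q where "q = conj_exp p"
  have q: "1 < q" "q * (p - 1) = p" using p by (auto simp: q_def conj_exp_def field_simps)
  have pos: "0 < A" "0 < V" "0 < H" "0 < S"
    using Q v p set_integrable_sqrt[OF v(1,2,3) Q(1)] unfolding A_def V_def H_def S_def
    by (auto intro!: set_integral_pos elim!: eventually_mono)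
  have "avg Q (\<lambda>x. epowr (ennreal (v x)) (1 - q)) = avg Q (\<lambda>x. ennreal (v x powr (1 - q)))"
    using v(4) by (intro avg_cong_AE) (auto elim!: eventually_mono simp: epowr_ennreal)
  also have "\<dots> = ennreal (S / A)"
    using p Q unfolding S_def A_def q_def by (intro avg_eq_integral) auto
  finally have Ap: "Ap_on p v Q = ennreal (V / A * (S / A) powr (p - 1))"
    using p pos avg_eq_integral[OF v(1,3) Q]
    by (simp add: Ap_on_def epowr_ennreal V_def[symmetric] A_def[symmetric] q_def[symmetric]
        flip: ennreal_mult)
  have "ennreal (V / A * (A / H)\<^sup>2) \<le> Ainf_exp_on v Q"
    using Ainf_exp_on_ge[OF Q v _ p(2)] q unfolding A_def V_def H_def q_def by simp
  then have "epowr (ennreal (V / A * (A / H)\<^sup>2)) (1 / q) \<le> epowr (Ainf_exp_on v Q) (1 / q)"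
    using q by (intro epowr_mono) auto
  then have "epowr (Ap_on p v Q) (1 / p) * epowr (ennreal (V / A * (A / H)\<^sup>2)) (1 / q)
      \<le> epowr (Ap_on p v Q) (1 / p) * epowr (Ainf_exp_on v Q) (1 / q)"
    by (rule mult_left_mono) simp
  also have "\<dots> \<le> ennreal B" using B(1) unfolding q_def .
  finally have "epowr (ennreal (V / A * (S / A) powr (p - 1))) (1 / p) *
      epowr (ennreal (V / A * (A / H)\<^sup>2)) (1 / q) \<le> ennreal B"
    unfolding Ap .
  then have "(V / A * (S / A) powr (p - 1)) powr (1 / p) * (V / A * (A / H)\<^sup>2) powr (1 / q) \<le> B"
    by (rule epowr_mult_le_imp) (use pos B(2) in auto)
  then have "((V / A * (S / A) powr (p - 1)) powr (1 / p) * (V / A * (A / H)\<^sup>2) powr (1 / q)) powr q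
      \<le> B powr q"
    using q by (intro powr_mono2) auto
  also have "((V / A * (S / A) powr (p - 1)) powr (1 / p) * (V / A * (A / H)\<^sup>2) powr (1 / q)) powr q
     = (V / A) powr (q / p + 1) * (S / A) * (A / H)\<^sup>2"
    using pos p q by (intro powr_mixed_identity) auto
  also have "q / p + 1 = q" using q p by (simp add: field_simps)
  finally have "(V / A) powr q * S * A / H\<^sup>2 \<le> B powr q"
    using pos by (simp add: power2_eq_square field_simps)
  then have "(V / A) powr q * S \<le> B powr q * H\<^sup>2 / A"
    using pos by (simp add: field_simps)
  then show ?thesis unfolding A_def V_def H_def S_def q_def .
qed

section \<open>The endpoint \<open>p = 1\<close>\<close>

lemma AE_ess_inf_on_le: "AE x in lebesgue. x \<in> Q \<longrightarrow> ess_inf_on Q h \<le> h x"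
proof -
  let ?A = "{z. AE x in lebesgue. x \<in> Q \<longrightarrow> z \<le> h x}"
  have "0 \<in> ?A" by simp
  then have "?A \<noteq> {}" by blast
  \<comment> \<open>A sequence with the same supremum reduces an uncountable family of exceptional
    null sets to a countable one.\<close>
  then obtain f :: "nat \<Rightarrow> ennreal" where f: "range f \<subseteq> ?A" "Sup ?A = (SUP i. f i)"
    using ennreal_Sup_countable_SUP[of ?A] by blast
  have "AE x in lebesgue. \<forall>i. x \<in> Q \<longrightarrow> f i \<le> h x"
    unfolding AE_all_countable using f(1) by auto
  then show ?thesis
    unfolding ess_inf_on_def f(2) by eventually_elim (auto intro: SUP_least)
qed

text \<open>The essential infimum is positive and finite: the value \<open>0\<close> would make its
  \<open>inverse\<close> equal to \<open>top\<close>, and the value \<open>top\<close> would force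
  \<open>Q\<close> to be null.\<close>

lemma A1_lower_bound:
  fixes v :: "real ^ 'n \<Rightarrow> real"
  assumes Q: "Q \<in> lmeasurable" "0 < measure lebesgue Q"
    and v: "set_integrable lebesgue Q v" "\<And>x. 0 \<le> v x" "0 < (LINT x:Q|lebesgue. v x)"
    and B: "Ap_on 1 v Q \<le> ennreal B" "0 \<le> B"
  shows "0 < B" "AE x in lebesgue. x \<in> Q \<longrightarrow> (LINT x:Q|lebesgue. v x) / (measure lebesgue Q * B) \<le> v x"
proof -
  define a where "a = (LINT x:Q|lebesgue. v x) / measure lebesgue Q"
  define e where "e = ess_inf_on Q (\<lambda>x. ennreal (v x))"
  have a: "0 < a" using Q v by (simp add: a_def)
  have le: "ennreal a * inverse e \<le> ennreal B"
    using B v Q by (simp add: Ap_on_def e_def a_def avg_eq_integral)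
  have AE: "AE x in lebesgue. x \<in> Q \<longrightarrow> e \<le> ennreal (v x)"
    unfolding e_def by (rule AE_ess_inf_on_le)
  have "e \<noteq> top"
  proof
    assume "e = top"
    with AE have "AE x in lebesgue. x \<notin> Q" by (auto elim!: eventually_mono simp: top_unique)
    with not_AE_notin[OF Q] show False by blast
  qed
  moreover have "e \<noteq> 0"
  proof
    assume "e = 0"
    with le a show False by (simp add: ennreal_mult_top top_unique)
  qed
  ultimately obtain r where r: "e = ennreal r" "0 < r" by (cases e) auto
  have "a / r \<le> B"
    using le r a B(2) by (simp add: inverse_ennreal divide_inverse flip: ennreal_mult')
  moreover have "0 < a / r" using a r by simp
  ultimately show "0 < B" by linarith
  with \<open>a / r \<le> B\<close> r have "a / B \<le> r" by (simp add: field_simps)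
  then show "AE x in lebesgue. x \<in> Q \<longrightarrow> (LINT x:Q|lebesgue. v x) / (measure lebesgue Q * B) \<le> v x"
    using AE v(2) unfolding r a_def by (auto elim!: eventually_mono simp: ennreal_le_iff)
qed

text \<open>The pointwise bound \<open>v >= z = v_Q / B\<close> replaces Jensen's inequality: it
  gives \<open>S <= |Q| / z\<close> and \<open>H >= sqrt z * |Q|\<close>, and
  \<open>v_Q = z B\<close> balances the powers.\<close>

lemma key_bound_A1:
  fixes v :: "real ^ 'n \<Rightarrow> real"
  assumes Q: "Q \<in> lmeasurable" "0 < measure lebesgue Q"
    and v: "set_integrable lebesgue Q v" "v \<in> borel_measurable lebesgue" "\<And>x. 0 \<le> v x"
      "0 < (LINT x:Q|lebesgue. v x)"
    and B: "Ap_on 1 v Q \<le> ennreal B" "0 \<le> B"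
  shows "set_integrable lebesgue Q (\<lambda>x. v x powr (1 - 2))"
    and "((LINT x:Q|lebesgue. v x) / measure lebesgue Q) powr 2 *
      (LINT x:Q|lebesgue. v x powr (1 - 2))
    \<le> B powr 2 * (LINT x:Q|lebesgue. sqrt (v x))\<^sup>2 / measure lebesgue Q"
proof -
  define A V H S where "A = measure lebesgue Q" and "V = (LINT x:Q|lebesgue. v x)"
    and "H = (LINT x:Q|lebesgue. sqrt (v x))"
    and "S = (LINT x:Q|lebesgue. v x powr (1 - 2))"
  define z where "z = V / (A * B)"
  have "0 < B" and AE: "AE x in lebesgue. x \<in> Q \<longrightarrow> z \<le> v x"
    using A1_lower_bound[OF Q v(1,3,4) B] by (auto simp: z_def V_def A_def)
  have pos: "0 < A" "0 < V" "0 < z" using Q v \<open>0 < B\<close> by (auto simp: A_def V_def z_def)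
  have Qs: "Q \<in> sets lebesgue" using Q by auto
  have one: "set_integrable lebesgue Q (\<lambda>x. c :: real)" for c
    using Q by (auto simp: set_integrable_def fmeasurable_def)
  have const: "(LINT x:Q|lebesgue. c) = c * A" for c :: real
    using set_integral_const[of Q lebesgue c] Q by (auto simp: fmeasurable_def A_def)
  have bd: "AE x in lebesgue. x \<in> Q \<longrightarrow> v x powr (1 - 2) \<le> 1 / z"
    using AE
  proof eventually_elim
    case (elim x)
    show ?case
    proof
      assume "x \<in> Q"
      with elim pos have "z \<le> v x" "0 < v x" by auto
      then show "v x powr (1 - 2) \<le> 1 / z"
        using pos by (simp add: powr_minus_divide frac_le)
    qed
  qed
  show 1: "set_integrable lebesgue Q (\<lambda>x. v x powr (1 - 2))"
  proof (rule set_integrable_bound[OF one[of "1 / z"]])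
    show "set_borel_measurable lebesgue Q (\<lambda>x. v x powr (1 - 2))"
      using v(2) Qs unfolding set_borel_measurable_def by measurable
    show "AE x in lebesgue. x \<in> Q \<longrightarrow> norm (v x powr (1 - 2)) \<le> norm (1 / z)"
      using bd pos by (auto elim!: eventually_mono)
  qed
  have "S \<le> (LINT x:Q|lebesgue. 1 / z)"
    unfolding S_def using 1 one bd by (intro set_integral_mono_AE) auto
  then have S: "S \<le> A / z" by (simp add: const)
  have "(LINT x:Q|lebesgue. sqrt z) \<le> H"
    unfolding H_def using one set_integrable_sqrt[OF v(1,2,3) Q(1)] AE
    by (intro set_integral_mono_AE) (auto elim!: eventually_mono)
  then have "sqrt z * A \<le> H" by (simp add: const)
  then have "(sqrt z * A)\<^sup>2 \<le> H\<^sup>2" using pos by (intro power_mono) auto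
  then have H: "z * A\<^sup>2 \<le> H\<^sup>2" using pos by (simp add: power_mult_distrib)
  have "V / A = z * B" using pos \<open>0 < B\<close> by (simp add: z_def)
  then have "(V / A)\<^sup>2 * S \<le> (z * B)\<^sup>2 * (A / z)"
    unfolding \<open>V / A = z * B\<close> by (intro mult_left_mono S) simp
  also have "\<dots> = B\<^sup>2 * (z * A\<^sup>2) / A" using pos by (simp add: power2_eq_square)
  also have "\<dots> \<le> B\<^sup>2 * H\<^sup>2 / A" using H pos by (intro divide_right_mono mult_left_mono) auto
  finally have "(V / A) powr 2 * S \<le> B powr 2 * H\<^sup>2 / A"
    using pos \<open>0 < B\<close> by (simp add: powr_numeral)
  then show "((LINT x:Q|lebesgue. v x) / measure lebesgue Q) powr 2 *
      (LINT x:Q|lebesgue. v x powr (1 - 2))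
    \<le> B powr 2 * (LINT x:Q|lebesgue. sqrt (v x))\<^sup>2 / measure lebesgue Q"
    unfolding A_def V_def H_def S_def .
qed

section \<open>Positivity of the weight and integrability of its dual\<close>

lemma dual_weight_of_Ap_on_finite:
  fixes v :: "real ^ 'n \<Rightarrow> real"
  assumes Q: "Q \<in> lmeasurable" "0 < measure lebesgue Q"
    and v: "set_integrable lebesgue Q v" "v \<in> borel_measurable lebesgue" "\<And>x. 0 \<le> v x"
      "0 < (LINT x:Q|lebesgue. v x)"
    and p: "1 < p" "Ap_on p v Q < top"
  shows "set_integrable lebesgue Q (\<lambda>x. v x powr (1 - conj_exp p))"
    and "AE x in lebesgue. x \<in> Q \<longrightarrow> 0 < v x"
proof -
  define q where "q = conj_exp p"
  have q: "1 < q" using p by (auto simp: q_def conj_exp_def field_simps)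
  \<comment> \<open>On the reals \<open>0 powr (1 - q) = 0\<close> would hide the zeros of
    \<open>v\<close>; here they carry the value \<open>top\<close>, so a finite integral of
    \<open>s\<close> makes them a null set.\<close>
  define s where "s = (\<lambda>x. if v x = 0 then top else ennreal (v x powr (1 - q)))"
  have s_eq: "epowr (ennreal (v x)) (1 - q) = s x" for x
    using v(3)[of x] q by (simp add: s_def epowr_def ennreal_eq_0_iff order_less_le)
  have Qs[measurable]: "Q \<in> sets lebesgue" using Q by auto
  have [measurable]: "s \<in> borel_measurable lebesgue" using v(2) unfolding s_def by measurable
  have "Ap_on p v Q = ennreal ((LINT x:Q|lebesgue. v x) / measure lebesgue Q) * epowr (avg Q s) (p - 1)"
    using p v Q by (simp add: Ap_on_def avg_eq_integral s_eq flip: q_def)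
  moreover have "ennreal ((LINT x:Q|lebesgue. v x) / measure lebesgue Q) \<noteq> 0"
    using divide_pos_pos[OF v(4) Q(2)] by (simp add: ennreal_eq_0_iff not_le)
  ultimately have "avg Q s \<noteq> top"
    using p by (auto simp: epowr_def ennreal_mult_top)
  then have fin: "(\<integral>\<^sup>+x\<in>Q. s x \<partial>lebesgue) \<noteq> \<infinity>"
    using Q unfolding avg_def by (auto simp: emeasure_eq_measure2 ennreal_top_divide)
  then have "AE x in lebesgue. s x * indicator Q x \<noteq> \<infinity>"
    by (intro nn_integral_noteq_infinite) auto
  then show "AE x in lebesgue. x \<in> Q \<longrightarrow> 0 < v x"
    using v(3) by (auto elim!: eventually_mono simp: s_def order_less_le)
  show "set_integrable lebesgue Q (\<lambda>x. v x powr (1 - conj_exp p))"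
    unfolding set_integrable_def q_def[symmetric]
  proof (rule integrableI_bounded)
    show "(\<lambda>x. indicator Q x *\<^sub>R v x powr (1 - q)) \<in> borel_measurable lebesgue"
      using v(2) by measurable
    have "(\<integral>\<^sup>+x. ennreal (norm (indicator Q x *\<^sub>R v x powr (1 - q))) \<partial>lebesgue)
        \<le> (\<integral>\<^sup>+x\<in>Q. s x \<partial>lebesgue)"
      by (intro nn_integral_mono) (auto simp: s_def indicator_def)
    also have "\<dots> < \<infinity>" using fin by (simp add: less_top)
    finally show "(\<integral>\<^sup>+x. ennreal (norm (indicator Q x *\<^sub>R v x powr (1 - q))) \<partial>lebesgue) < \<infinity>" .
  qed
qed

text \<open>If \<open>v\<close> is not almost everywhere zero, all large cubes have positive mass, and there the
  $A_p$ condition forbids \<open>v\<close> to vanish on a set of positive measure.\<close>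

lemma Ap_weight_dual:
  fixes v :: "real ^ 'n \<Rightarrow> real"
  assumes v: "in_Ap p v" and p: "1 \<le> p" and nz: "\<not> (AE x in lebesgue. v x = 0)"
  shows "AE x in lebesgue. 0 < v x"
    and "set_integrable lebesgue (dyadic_cube k j)
      (\<lambda>x. v x powr (1 - (if p = 1 then 2 else conj_exp p)))"
proof -
  define q where "q = (if p = 1 then 2 else conj_exp p)"
  define K :: "nat \<Rightarrow> (real ^ 'n) set" where "K n = cbox (\<chi> i. - real n) (\<chi> i. real n)" for n
  have w: "weight v" using v by (simp add: in_Ap_def)
  have v0: "0 \<le> v x" for x using w by (simp add: weight_def)
  have vm: "v \<in> borel_measurable lebesgue" using w by (rule borel_measurable_weight)
  have vi: "set_integrable lebesgue (K n) v" for n using w by (simp add: weight_def K_def)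
  have Kmono: "K m \<subseteq> K n" if "m \<le> n" for m n
  proof
    fix x assume x: "x \<in> K m"
    have "- real n \<le> x $ i \<and> x $ i \<le> real n" for i
    proof -
      have "- real m \<le> x $ i" "x $ i \<le> real m" using x by (auto simp: K_def mem_box_cart)
      then show ?thesis using that by linarith
    qed
    then show "x \<in> K n" by (simp add: K_def mem_box_cart)
  qed
  have Kcover: "\<exists>n\<ge>m. x \<in> K n" for m x
  proof -
    obtain n where "norm x \<le> real n" using real_arch_simple by blast
    then have "- real (max m n) \<le> x $ i \<and> x $ i \<le> real (max m n)" for i
      using component_le_norm_cart[of x i] by linarith
    then have "x \<in> K (max m n)" unfolding K_def by (simp add: mem_box_cart)
    then show ?thesis by (intro exI[of _ "max m n"]) auto
  qed
  obtain m where m: "0 < (LINT x:K m|lebesgue. v x)"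
  proof (rule ccontr)
    assume "\<not> thesis"
    with that have "\<not> 0 < (LINT x:K n|lebesgue. v x)" for n by blast
    then have zero: "(LINT x:K n|lebesgue. v x) = 0" for n
      using set_integral_nonneg[of v lebesgue "K n"] v0 by (simp add: order_less_le)
    have "AE x in lebesgue. indicator (K n) x *\<^sub>R v x = 0" for n
      using zero[of n] vi[of n] v0 unfolding set_lebesgue_integral_def set_integrable_def
      by (subst (asm) integral_nonneg_eq_0_iff_AE) auto
    then have "AE x in lebesgue. \<forall>n. indicator (K n) x *\<^sub>R v x = 0"
      unfolding AE_all_countable by blast
    then have "AE x in lebesgue. v x = 0"
    proof eventually_elim
      case (elim x)
      obtain n where "x \<in> K n" using Kcover[of 0] by blast
      with elim[rule_format, of n] show ?case by simp
    qed
    with nz show False by blast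
  qed
  \<comment> \<open>The bound \<open>Suc m\<close> rather than \<open>m\<close> excludes
    \<open>n = 0\<close>, where \<open>K 0\<close> is a single point and not a cube.\<close>
  have good: "set_integrable lebesgue (K n) (\<lambda>x. v x powr (1 - q)) \<and>
      (AE x in lebesgue. x \<in> K n \<longrightarrow> 0 < v x)" if n: "Suc m \<le> n" for n
  proof -
    have "K n = cbox (\<chi> i. - real n) ((\<chi> i. - real n) + (\<chi> i. 2 * real n))"
      unfolding K_def by (rule arg_cong[of _ _ "cbox _"]) (simp add: vec_eq_iff)
    then have cube: "K n \<in> cubes" using n unfolding cubes_def by force
    note Q = cbox_cube_measure[OF cube]
    have "(LINT x:K m|lebesgue. v x) \<le> (LINT x:K n|lebesgue. v x)"
      using vi[of m] vi[of n] Kmono[of m n] n v0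
      unfolding set_lebesgue_integral_def set_integrable_def
      by (intro integral_mono) (auto simp: indicator_def)
    with m have V: "0 < (LINT x:K n|lebesgue. v x)" by simp
    have "Ap_on p v (K n) \<le> Ap_const p v" unfolding Ap_const_def using cube by (rule SUP_upper)
    also have "\<dots> < top" using v by (simp add: in_Ap_def)
    finally have Ap: "Ap_on p v (K n) < top" .
    show ?thesis
    proof (cases "p = 1")
      case True
      define B where "B = enn2real (Ap_on 1 v (K n))"
      have B: "Ap_on 1 v (K n) \<le> ennreal B" "0 \<le> B" using Ap True by (simp_all add: B_def)
      have "set_integrable lebesgue (K n) (\<lambda>x. v x powr (1 - q))"
        using key_bound_A1(1)[OF Q vi vm v0 V B] True by (simp add: q_def)
      moreover have "0 < (LINT x:K n|lebesgue. v x) / (measure lebesgue (K n) * B)"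
        using A1_lower_bound(1)[OF Q vi v0 V B] V Q by simp
      then have "AE x in lebesgue. x \<in> K n \<longrightarrow> 0 < v x"
        using A1_lower_bound(2)[OF Q vi v0 V B] by (auto elim!: eventually_mono)
      ultimately show ?thesis ..
    next
      case False
      then show ?thesis
        using dual_weight_of_Ap_on_finite[OF Q vi vm v0 V _ Ap] p by (simp add: q_def)
    qed
  qed
  have "AE x in lebesgue. \<forall>n. Suc m \<le> n \<longrightarrow> x \<in> K n \<longrightarrow> 0 < v x"
    unfolding AE_all_countable using good by auto
  then show "AE x in lebesgue. 0 < v x"
    using Kcover[of "Suc m"] by (auto elim!: eventually_mono)
  obtain n where n: "dyadic_cube k j \<subseteq> K n"
    unfolding K_def by (rule dyadic_cube_subset_cbox)
  then have "dyadic_cube k j \<subseteq> K (max n (Suc m))" using Kmono[of n "max n (Suc m)"] by auto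
  then show "set_integrable lebesgue (dyadic_cube k j)
      (\<lambda>x. v x powr (1 - (if p = 1 then 2 else conj_exp p)))"
    unfolding q_def[symmetric] using good[of "max n (Suc m)"]
    by (auto intro: set_integrable_subset dyadic_cube_measure)
qed

section \<open>The integral inequality on every dyadic cube\<close>

lemma Ap_dyadic_key_bound:
  fixes v :: "real ^ 'n \<Rightarrow> real"
  assumes v: "in_Ap p v" and p: "1 \<le> p" and nz: "\<not> (AE x in lebesgue. v x = 0)"
    and B: "mixed_const p (1 / p) (1 / conj_exp p) v = ennreal B" "0 \<le> B"
  defines "q \<equiv> if p = 1 then 2 else conj_exp p"
  shows "((LINT x:dyadic_cube k j|lebesgue. v x) / measure lebesgue (dyadic_cube k j)) powr q *
      (LINT x:dyadic_cube k j|lebesgue. v x powr (1 - q))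
    \<le> B powr q * (LINT x:dyadic_cube k j|lebesgue. sqrt (v x))\<^sup>2 / measure lebesgue (dyadic_cube k j)"
proof -
  let ?D = "dyadic_cube k j"
  have w: "weight v" using v by (simp add: in_Ap_def)
  have v0: "0 \<le> v x" for x using w by (simp add: weight_def)
  have vm: "v \<in> borel_measurable lebesgue" using w by (rule borel_measurable_weight)
  note vi = weight_integrable_dyadic_cube[OF w, of k j]
  note Q = dyadic_cube_measure(2,3)[of k j]
  have pos: "AE x in lebesgue. x \<in> ?D \<longrightarrow> 0 < v x"
    using Ap_weight_dual(1)[OF v p nz] by (auto elim!: eventually_mono)
  note le = mixed_const_ge_dyadic[of p v k j "1 / p" "1 / conj_exp p", unfolded B(1)]
  show ?thesis
  proof (cases "p = 1")
    case True
    \<comment> \<open>For \<open>p = 1\<close> the exponents are \<open>1\<close> and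
      \<open>0\<close>, and \<open>epowr _ 0 = 1\<close> removes the exponential factor even if it
      is infinite.\<close>
    have "epowr x 1 = x" for x by (cases x) (auto simp: epowr_def)
    then have "Ap_on 1 v ?D \<le> ennreal B" using le True by (simp add: conj_exp_def epowr_def[of _ 0])
    then show ?thesis
      using key_bound_A1(2)[OF Q vi vm v0 _ _ B(2)] set_integral_pos[OF vi Q v0 pos] True
      by (simp add: q_def)
  next
    case False
    then show ?thesis
      using key_bound_Ap[OF Q vi vm v0 pos _ _ le B(2)] Ap_weight_dual(2)[OF v p nz] p
      by (simp add: q_def)
  qed
qed

section \<open>The weak type estimate\<close>

text \<open>Points of the cube where \<open>v\<close> lies below \<open>P\<close> or below one of the averages \<open>a\<close> over the
  dyadic cubes of the next \<open>N\<close> generations containing the point; the cube itself does not count,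
  which allows the descent to start at \<open>P = 0\<close>.\<close>

primrec low_set ::
  "(real ^ 'n \<Rightarrow> real) \<Rightarrow> (int \<Rightarrow> int ^ 'n \<Rightarrow> real) \<Rightarrow> nat \<Rightarrow> int \<Rightarrow> int ^ 'n \<Rightarrow> real \<Rightarrow> (real ^ 'n) set"
where
  "low_set v a 0 k j P = {x \<in> dyadic_cube k j. v x < P}"
| "low_set v a (Suc N) k j P = (\<Union>c\<in>dyadic_children j. low_set v a N (k - 1) c (max P (a (k - 1) c)))"

lemma low_set_subset: "low_set v a N k j P \<subseteq> dyadic_cube k j"
proof (induction N arbitrary: k j P)
  case (Suc N)
  then show ?case unfolding dyadic_cube_eq_Union_children[of k j] by fastforce
qed auto

lemma sets_lebesgue_Collect_less:
  fixes v :: "real ^ 'n \<Rightarrow> real"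
  assumes "v \<in> borel_measurable lebesgue"
  shows "{x. v x < c} \<in> sets lebesgue"
  using measurable_sets[OF assms, of "{..<c}"] by (simp add: vimage_def)

lemma sets_low_set:
  assumes "v \<in> borel_measurable lebesgue"
  shows "low_set v a N k j P \<in> sets lebesgue"
proof (induction N arbitrary: k j P)
  case 0
  have "low_set v a 0 k j P = dyadic_cube k j \<inter> {x. v x < P}" by auto
  also have "\<dots> \<in> sets lebesgue"
    using assms by (intro sets.Int dyadic_cube_measure sets_lebesgue_Collect_less)
  finally show ?case .
qed (auto intro!: sets.finite_UN simp: finite_dyadic_children)

lemma mem_low_set:
  assumes "x \<in> dyadic_cube k j"
    and "v x < P \<or> (\<exists>i\<in>{k - int N..<k}. v x < a i (dyadic_index i x))"
  shows "x \<in> low_set v a N k j P"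
  using assms
proof (induction N arbitrary: k j P)
  case (Suc N)
  obtain c where c: "c \<in> dyadic_children j" "x \<in> dyadic_cube (k - 1) c"
    using Suc.prems(1) unfolding dyadic_cube_eq_Union_children[of k j] by blast
  have "v x < max P (a (k - 1) c) \<or> (\<exists>i\<in>{k - 1 - int N..<k - 1}. v x < a i (dyadic_index i x))"
  proof (cases "v x < P")
    case False
    then obtain i where i: "i \<in> {k - int (Suc N)..<k}" "v x < a i (dyadic_index i x)"
      using Suc.prems(2) by blast
    show ?thesis
    proof (cases "i = k - 1")
      case True
      then show ?thesis using i c by (simp add: mem_dyadic_cube_iff less_max_iff_disj)
    next
      case False
      then show ?thesis using i by (intro disjI2 bexI[of _ i]) auto
    qed
  qed auto
  then have "x \<in> low_set v a N (k - 1) c (max P (a (k - 1) c))"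
    by (rule Suc.IH[OF c(2)])
  then show ?case using c(1) by auto
qed auto

lemma emeasure_weight_measure:
  fixes v :: "real ^ 'n \<Rightarrow> real"
  assumes "v \<in> borel_measurable lebesgue" "A \<in> sets lebesgue"
  shows "emeasure (weight_measure v) A = (\<integral>\<^sup>+x\<in>A. ennreal (v x) \<partial>lebesgue)"
  using assms unfolding weight_measure_def by (intro emeasure_density) auto

text \<open>The nodes of the tree are the pairs \<open>(k, j)\<close>. The right side is phrased as
  a measure of the cube so that the estimates can be added over countably many disjoint
  cubes.\<close>

lemma low_set_bound:
  fixes v g :: "real ^ 'n \<Rightarrow> real"
  assumes v: "v \<in> borel_measurable lebesgue" "\<And>x. 0 \<le> v x" "AE x in lebesgue. 0 < v x"
    "\<And>k j. set_integrable lebesgue (dyadic_cube k j) v"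
    and q: "1 < q" "\<And>k j. set_integrable lebesgue (dyadic_cube k j) (\<lambda>x. v x powr (1 - q))"
    and B: "0 \<le> B"
    and key: "\<And>k j. ((LINT x:dyadic_cube k j|lebesgue. v x) / measure lebesgue (dyadic_cube k j)) powr q *
        (LINT x:dyadic_cube k j|lebesgue. v x powr (1 - q))
      \<le> B powr q * (LINT x:dyadic_cube k j|lebesgue. sqrt (v x))\<^sup>2 / measure lebesgue (dyadic_cube k j)"
    and g: "integrable lebesgue g" "\<And>x. 0 \<le> g x"
  defines "a \<equiv> \<lambda>k j. (LINT x:dyadic_cube k j|lebesgue. g x) / measure lebesgue (dyadic_cube k j)"
  shows "emeasure (weight_measure v) (low_set v a N k j 0)
    \<le> ennreal ((4 * (q / (q - 1)) + 3) * B) * emeasure (weight_measure g) (dyadic_cube k j)"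
proof -
  define W where "W = weight_measure v"
  define vol V G S H where "vol = (\<lambda>(k, j). measure lebesgue (dyadic_cube k j :: (real ^ 'n) set))"
    and "V = (\<lambda>(k, j). LINT x:dyadic_cube k j|lebesgue. v x)"
    and "G = (\<lambda>(k, j). LINT x:dyadic_cube k j|lebesgue. g x)"
    and "S = (\<lambda>(k, j). LINT x:dyadic_cube k j|lebesgue. v x powr (1 - q))"
    and "H = (\<lambda>(k, j). LINT x:dyadic_cube k j|lebesgue. sqrt (v x))"
  define C where "C = (\<lambda>(k, j :: int ^ 'n). Pair (k - 1 :: int) ` dyadic_children j)"
  define m where "m N Q P = measure W (low_set v a N (fst Q) (snd Q) P)" for N Q P
  note defs = vol_def V_def G_def S_def H_def
  note D = dyadic_cube_measure
  have gi: "set_integrable lebesgue (dyadic_cube k j) g" for k j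
    using g(1) D(1)[of k j] unfolding set_integrable_def by (intro integrable_mult_indicator) auto
  have hi: "set_integrable lebesgue (dyadic_cube k j) (\<lambda>x. sqrt (v x))" for k j
    using v D by (intro set_integrable_sqrt) auto
  have one: "set_integrable lebesgue (dyadic_cube k j) (\<lambda>x. 1 :: real)" for k and j :: "int ^ 'n"
    using D(2)[of k j] by (auto simp: set_integrable_def fmeasurable_def)
  have vol: "measure lebesgue (dyadic_cube k j) = (LINT x:dyadic_cube k j|lebesgue. 1 :: real)" for k and j :: "int ^ 'n"
    using set_integral_const[of "dyadic_cube k j" lebesgue "1 :: real"] D(2)[of k j]
    by (auto simp: fmeasurable_def)
  have sum_C: "sum h (C (k, j)) = (\<Sum>c\<in>dyadic_children j. h (k - 1, c))" for h :: "_ \<Rightarrow> real" and k j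
    unfolding C_def by (simp add: sum.reindex inj_on_def)
  have W_D: "emeasure W (dyadic_cube k j) = ennreal (V (k, j))" for k j
    unfolding W_def V_def using v D(1)[of k j]
    by (simp add: emeasure_weight_measure nn_set_integral_eq)
  have W_sets: "sets W = sets lebesgue" by (simp add: W_def weight_measure_def)
  have fm: "low_set v a N k j P \<in> fmeasurable W" for N k j P
  proof (rule fmeasurableI2)
    show "dyadic_cube k j \<in> fmeasurable W"
      using D(1)[of k j] by (auto simp: fmeasurable_def W_sets W_D)
    show "low_set v a N k j P \<in> sets W" by (simp add: W_sets sets_low_set v)
  qed (rule low_set_subset)
  have V_pos: "0 < V (k, j)" for k j
    unfolding V_def using v D by (auto intro!: set_integral_pos elim!: eventually_mono)
  have S_pos: "0 < S (k, j)" for k j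
    unfolding S_def prod.case using q v(3) D by (intro set_integral_pos) (auto elim!: eventually_mono)
  have "0 < (V (k, j) / vol (k, j)) powr q * S (k, j)"
    using V_pos[of k j] S_pos[of k j] D(3)[of k j] by (simp add: vol_def)
  also have "\<dots> \<le> B powr q * (H (k, j))\<^sup>2 / vol (k, j)"
    using key[of k j] by (simp add: defs)
  \<comment> \<open>Positivity is required for \<open>1 / (exp 1 * B)\<close>; it holds because the
    left side of \<open>key\<close> is positive while \<open>0 powr q = 0\<close>.\<close>
  finally have "0 < B" using B by (cases "B = 0") auto
  have "m N (k, j) 0 \<le> (4 * (q / (q - 1)) + 3) * B * G (k, j)"
  proof (rule tree_weak_bound[where C = C and vol = vol and V = V and S = S and H = H])
    fix Q :: "int \<times> (int ^ 'n)" and N :: nat and P :: real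
    obtain k j where Q: "Q = (k, j)" by (cases Q)
    show "0 < vol Q" unfolding Q vol_def by (simp add: D)
    show "0 < V Q" "0 \<le> S Q" unfolding Q using V_pos S_pos by (simp_all add: less_imp_le)
    show "0 \<le> G Q" unfolding Q G_def by (simp add: set_integral_nonneg g)
    show "vol Q = sum vol (C Q)"
      unfolding Q sum_C vol_def prod.case vol by (rule set_integral_dyadic_children) (rule one)
    show "V Q = sum V (C Q)"
      unfolding Q sum_C V_def prod.case by (rule set_integral_dyadic_children) (rule v)
    show "G Q = sum G (C Q)"
      unfolding Q sum_C G_def prod.case by (rule set_integral_dyadic_children) (rule gi)
    show "S Q = sum S (C Q)"
      unfolding Q sum_C S_def prod.case by (rule set_integral_dyadic_children) (rule q)
    show "H Q = sum H (C Q)"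
      unfolding Q sum_C H_def prod.case by (rule set_integral_dyadic_children) (rule hi)
    show "(H Q)\<^sup>2 \<le> vol Q * V Q"
      unfolding Q H_def vol_def V_def prod.case using v D by (intro set_integral_sqrt_square_le) auto
    show "(V Q / vol Q) powr q * S Q \<le> B powr q * (H Q)\<^sup>2 / vol Q"
      unfolding Q defs prod.case by (rule key)
    have "measure W (low_set v a N k j P) \<le> measure W (dyadic_cube k j)"
      using D(1)[of k j] fm
      by (intro measure_mono_fmeasurable low_set_subset) (auto simp: fmeasurable_def W_sets W_D)
    also have "\<dots> = V (k, j)" using W_D[of k j] V_pos[of k j] by (simp add: measure_def)
    finally show "m N Q P \<le> V Q" by (simp add: m_def Q)
    show "m (Suc N) Q P \<le> (\<Sum>c\<in>C Q. m N c (max P (G c / vol c)))"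
      unfolding Q sum_C m_def
      using fm by (auto simp: a_def G_def vol_def finite_dyadic_children intro!: measure_UNION_le dest: fmeasurableD)
    show "m 0 Q P \<le> P powr q * S Q" if "0 \<le> P"
    proof -
      have "emeasure W (low_set v a 0 k j P) =
          (\<integral>\<^sup>+x\<in>low_set v a 0 k j P. ennreal (v x) \<partial>lebesgue)"
        unfolding W_def using v by (intro emeasure_weight_measure sets_low_set) auto
      also have "\<dots> \<le> (\<integral>\<^sup>+x\<in>dyadic_cube k j. ennreal (P powr q * v x powr (1 - q)) \<partial>lebesgue)"
      proof (rule nn_integral_mono)
        fix x
        \<comment> \<open>A Chebyshev estimate against the dual weight, from
          \<open>v = v^q v^(1-q)\<close>; it is the source of the term \<open>P^q S\<close> in
          \<open>bellman\<close>.\<close>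
        have "v x \<le> P powr q * v x powr (1 - q)" if "v x < P"
        proof (cases "v x = 0")
          case False
          then have "0 < v x" using v(2)[of x] by simp
          then have "v x = v x powr q * v x powr (1 - q)" by (simp flip: powr_add)
          also have "\<dots> \<le> P powr q * v x powr (1 - q)"
            using that \<open>0 < v x\<close> q by (intro mult_right_mono powr_mono2) auto
          finally show ?thesis .
        qed simp
        then show "ennreal (v x) * indicator (low_set v a 0 k j P) x
            \<le> ennreal (P powr q * v x powr (1 - q)) * indicator (dyadic_cube k j) x"
          by (auto simp: indicator_def intro!: ennreal_leI)
      qed
      also have "\<dots> = ennreal (P powr q * S (k, j))"
        using q(2)[of k j] by (subst nn_set_integral_eq) (auto simp: S_def)
      finally have "emeasure W (low_set v a 0 k j P) \<le> ennreal (P powr q * S (k, j))" .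
      then show ?thesis
        using S_pos[of k j] unfolding m_def Q by (simp add: measure_def enn2real_leI)
    qed
  qed (use q \<open>0 < B\<close> in auto)
  then have "ennreal (measure W (low_set v a N k j 0)) \<le> ennreal ((4 * (q / (q - 1)) + 3) * B * G (k, j))"
    by (intro ennreal_leI) (simp add: m_def)
  also have "\<dots> = ennreal ((4 * (q / (q - 1)) + 3) * B) * ennreal (G (k, j))"
    using q B by (intro ennreal_mult) (auto simp: G_def set_integral_nonneg g)
  also have "ennreal (G (k, j)) = emeasure (weight_measure g) (dyadic_cube k j)"
    using g gi[of k j] D(1)[of k j]
    by (simp add: G_def emeasure_weight_measure nn_set_integral_eq borel_measurable_integrable)
  also have "ennreal (measure W (low_set v a N k j 0)) = emeasure W (low_set v a N k j 0)"
    using fm[of N k j 0] by (simp add: emeasure_eq_measure2)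
  finally show ?thesis unfolding W_def .
qed

lemma dyadic_weak_bound:
  fixes v g :: "real ^ 'n \<Rightarrow> real"
  assumes v: "v \<in> borel_measurable lebesgue" "\<And>x. 0 \<le> v x" "AE x in lebesgue. 0 < v x"
    "\<And>k j. set_integrable lebesgue (dyadic_cube k j) v"
    and q: "1 < q" "\<And>k j. set_integrable lebesgue (dyadic_cube k j) (\<lambda>x. v x powr (1 - q))"
    and B: "0 \<le> B"
    and key: "\<And>k j. ((LINT x:dyadic_cube k j|lebesgue. v x) / measure lebesgue (dyadic_cube k j)) powr q *
        (LINT x:dyadic_cube k j|lebesgue. v x powr (1 - q))
      \<le> B powr q * (LINT x:dyadic_cube k j|lebesgue. sqrt (v x))\<^sup>2 / measure lebesgue (dyadic_cube k j)"
    and g: "integrable lebesgue g" "\<And>x. 0 \<le> g x"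
  defines "a \<equiv> \<lambda>k j. (LINT x:dyadic_cube k j|lebesgue. g x) / measure lebesgue (dyadic_cube k j)"
  shows "{x. \<exists>k. v x < a k (dyadic_index k x)} \<in> sets lebesgue"
    and "emeasure (weight_measure v) {x. \<exists>k. v x < a k (dyadic_index k x)}
    \<le> ennreal ((4 * (q / (q - 1)) + 3) * B) * (\<integral>\<^sup>+x. ennreal (g x) \<partial>lebesgue)"
proof -
  let ?c = "ennreal ((4 * (q / (q - 1)) + 3) * B)"
  define W where "W = weight_measure v"
  define T where "T N = {x. \<exists>k\<in>{- int N..<int N}. v x < a k (dyadic_index k x)}" for N
  have W_sets: "sets W = sets lebesgue" by (simp add: W_def weight_measure_def)
  have gW_sets: "sets (weight_measure g) = sets lebesgue" by (simp add: weight_measure_def)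
  have T_sets: "T N \<in> sets lebesgue" for N
  proof -
    have "T N = (\<Union>k\<in>{- int N..<int N}. \<Union>j. dyadic_cube k j \<inter> {x. v x < a k j})"
      by (auto simp: T_def mem_dyadic_cube_iff)
    also have "\<dots> \<in> sets lebesgue"
    proof (rule sets.finite_UN)
      fix k
      show "(\<Union>j. dyadic_cube k j \<inter> {x. v x < a k j}) \<in> sets lebesgue"
        using v(1) by (intro sets.countable_UN'' sets.Int dyadic_cube_measure sets_lebesgue_Collect_less) auto
    qed simp
    finally show ?thesis .
  qed
  have U: "{x. \<exists>k. v x < a k (dyadic_index k x)} = (\<Union>N. T N)"
  proof -
    have "k \<in> {- int (Suc (nat \<bar>k\<bar>))..<int (Suc (nat \<bar>k\<bar>))}" for k by auto
    then show ?thesis unfolding T_def by blast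
  qed
  show "{x. \<exists>k. v x < a k (dyadic_index k x)} \<in> sets lebesgue"
    unfolding U using T_sets by auto
  have T_le: "emeasure W (T N) \<le> ?c * (\<integral>\<^sup>+x. ennreal (g x) \<partial>lebesgue)" for N
  proof -
    \<comment> \<open>From level \<open>N\<close>, which is itself not counted, \<open>2 * N\<close>
      generations reach exactly the levels \<open>-N\<close> to \<open>N - 1\<close> of
      \<open>T N\<close>. All cubes of level \<open>N\<close> are used, since no increasing union of
      dyadic cubes covers the space.\<close>
    let ?L = "\<lambda>j. low_set v a (2 * N) (int N) j 0"
    have L: "?L j \<in> sets W" for j by (simp add: W_sets sets_low_set v)
    have "T N \<subseteq> (\<Union>j. ?L j)"
    proof
      fix x assume "x \<in> T N"
      then have "x \<in> ?L (dyadic_index (int N) x)"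
        by (intro mem_low_set) (auto simp: T_def mem_dyadic_cube_iff)
      then show "x \<in> (\<Union>j. ?L j)" by blast
    qed
    then have "emeasure W (T N) \<le> emeasure W (\<Union>j. ?L j)"
      using L by (intro emeasure_mono sets.countable_UN') auto
    also have "\<dots> = (\<integral>\<^sup>+j. emeasure W (?L j) \<partial>count_space UNIV)"
    proof (rule emeasure_UN_countable)
      show "disjoint_family_on ?L UNIV"
        using disjoint_dyadic_cubes[of "int N" UNIV] low_set_subset[of v a "2 * N" "int N" _ 0]
        unfolding disjoint_family_on_def by blast
    qed (use L in auto)
    also have "\<dots> \<le> (\<integral>\<^sup>+j. ?c * emeasure (weight_measure g) (dyadic_cube (int N) j) \<partial>count_space UNIV)"
      unfolding W_def a_def by (intro nn_integral_mono low_set_bound assms)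
    also have "\<dots> = ?c * (\<integral>\<^sup>+j. emeasure (weight_measure g) (dyadic_cube (int N) j) \<partial>count_space UNIV)"
      by (rule nn_integral_cmult) simp
    also have "(\<integral>\<^sup>+j. emeasure (weight_measure g) (dyadic_cube (int N) j) \<partial>count_space UNIV)
        = emeasure (weight_measure g) (\<Union>j. dyadic_cube (int N) j)"
      by (rule emeasure_UN_countable[symmetric])
        (auto simp: gW_sets dyadic_cube_measure disjoint_dyadic_cubes)
    also have "(\<Union>j. dyadic_cube (int N) j) = UNIV" by (auto simp: mem_dyadic_cube_iff)
    also have "emeasure (weight_measure g) UNIV = (\<integral>\<^sup>+x. ennreal (g x) \<partial>lebesgue)"
      using g by (simp add: emeasure_weight_measure borel_measurable_integrable)
    finally show ?thesis .
  qed
  have "incseq T" unfolding incseq_def T_def by fastforce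
  then have "emeasure W (\<Union>N. T N) = (SUP N. emeasure W (T N))"
    using T_sets by (intro SUP_emeasure_incseq[symmetric]) (auto simp: W_sets)
  also have "\<dots> \<le> ?c * (\<integral>\<^sup>+x. ennreal (g x) \<partial>lebesgue)"
    by (intro SUP_least T_le)
  finally show "emeasure (weight_measure v) {x. \<exists>k. v x < a k (dyadic_index k x)}
    \<le> ?c * (\<integral>\<^sup>+x. ennreal (g x) \<partial>lebesgue)"
    unfolding U W_def .
qed

lemma weak_L1_norm_bound:
  fixes v f :: "real ^ 'n \<Rightarrow> real"
  assumes v: "in_Ap p v" and p: "1 \<le> p" and f: "integrable (weight_measure v) f"
    and B: "mixed_const p (1 / p) (1 / conj_exp p) v = ennreal B" "0 \<le> B"
  shows "weak_L1_norm v (\<lambda>x. dyadic_maximal (\<lambda>y. f y * v y) x / ennreal (v x))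
    \<le> ennreal (11 * p * B) * L1_norm v f"
proof -
  have w: "weight v" using v by (simp add: in_Ap_def)
  have v0: "0 \<le> v x" for x using w by (simp add: weight_def)
  have vm: "v \<in> borel_measurable lebesgue" using w by (rule borel_measurable_weight)
  have fm: "f \<in> borel_measurable lebesgue"
    using borel_measurable_integrable[OF f] by (simp add: weight_measure_def)
  show ?thesis
  proof (cases "AE x in lebesgue. v x = 0")
    \<comment> \<open>The zero weight lies in \<open>A_p\<close> because \<open>0 * top = 0\<close>,
      but it has no dual weight; its measure vanishes, and so does the left side.\<close>
    case True
    have "emeasure (weight_measure v) A = 0" for A
    proof (cases "A \<in> sets lebesgue")
      case A: True
      have "(\<integral>\<^sup>+x\<in>A. ennreal (v x) \<partial>lebesgue) = (\<integral>\<^sup>+(x :: real ^ 'n). 0 \<partial>lebesgue)"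
        using True by (intro nn_integral_cong_AE) (auto elim!: eventually_mono)
      then show ?thesis using vm A by (simp add: emeasure_weight_measure)
    qed (simp add: emeasure_notin_sets weight_measure_def)
    then show ?thesis by (simp add: weak_L1_norm_def)
  next
    case nz: False
    define q where "q = (if p = 1 then 2 else conj_exp p)"
    \<comment> \<open>The quotient is \<open>p\<close> for \<open>p > 1\<close> and \<open>2\<close>
      for \<open>p = 1\<close>. With \<open>2 * p\<close> for both,
      \<open>4 * (2 * p) + 3 <= 11 * p\<close> gives the constant \<open>11\<close>.\<close>
    have q: "1 < q" "q / (q - 1) \<le> 2 * p"
      using p by (auto simp: q_def conj_exp_def field_simps)
    note D_int = weight_integrable_dyadic_cube[OF w]
    note pos = Ap_weight_dual(1)[OF v p nz]
    have int: "integrable lebesgue (\<lambda>x. \<bar>f x\<bar> * v x)"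
    proof -
      have "integrable lebesgue (\<lambda>x. v x *\<^sub>R f x)"
        using f fm vm v0 unfolding weight_measure_def by (subst (asm) integrable_density) auto
      from integrable_abs[OF this] show ?thesis by (simp add: abs_mult v0 mult.commute)
    qed
    have "ennreal t * emeasure (weight_measure v)
          {x. ennreal t < dyadic_maximal (\<lambda>y. f y * v y) x / ennreal (v x)}
        \<le> ennreal (11 * p * B) * L1_norm v f" if t: "0 < t" for t :: real
    proof -
      define g where "g = (\<lambda>x. \<bar>f x\<bar> * v x / t)"
      define a where "a k j = (LINT x:dyadic_cube k j|lebesgue. g x) / measure lebesgue (dyadic_cube k j)" for k j
      let ?T = "{x. \<exists>k. v x < a k (dyadic_index k x)}"
      let ?c = "ennreal ((4 * (q / (q - 1)) + 3) * B)"
      have g: "integrable lebesgue g" "0 \<le> g x" for x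
        using int t v0 by (auto simp: g_def)
      note T = dyadic_weak_bound[OF vm v0 pos D_int q(1) Ap_weight_dual(2)[OF v p nz, folded q_def] B(2)
          Ap_dyadic_key_bound[OF v p nz B, folded q_def] g, folded a_def]
      \<comment> \<open>Dividing by \<open>t\<close> in \<open>g\<close> turns the level set into a
        comparison of \<open>v\<close> with averages of \<open>g\<close>. Where
        \<open>v x = 0\<close> the quotient may be \<open>top\<close>, but these points have weight
        zero.\<close>
      have sub: "{x. ennreal t < dyadic_maximal (\<lambda>y. f y * v y) x / ennreal (v x)} \<subseteq> {x. v x = 0} \<union> ?T"
      proof safe
        fix x assume x: "ennreal t < dyadic_maximal (\<lambda>y. f y * v y) x / ennreal (v x)"
          and nT: "\<not> (\<exists>k. v x < a k (dyadic_index k x))"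
        show "v x = 0"
        proof (rule ccontr)
          assume "v x \<noteq> 0"
          then have vx: "0 < v x" using v0[of x] by simp
          have "dyadic_maximal (\<lambda>y. f y * v y) x \<le> ennreal (t * v x)"
            unfolding dyadic_maximal_def
          proof (rule SUP_least)
            fix Q assume "Q \<in> {Q \<in> dyadic_cubes. x \<in> Q}"
            then obtain k j where Q: "Q = dyadic_cube k j" "x \<in> dyadic_cube k j"
              by (auto simp: dyadic_cubes_eq)
            have "avg Q (\<lambda>y. ennreal \<bar>f y * v y\<bar>) = avg Q (\<lambda>y. ennreal (\<bar>f y\<bar> * v y))"
              by (simp add: abs_mult v0)
            also have "\<dots> = ennreal ((LINT y:Q|lebesgue. \<bar>f y\<bar> * v y) / measure lebesgue Q)"
            proof (rule avg_eq_integral)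
              show "set_integrable lebesgue Q (\<lambda>y. \<bar>f y\<bar> * v y)"
                using int dyadic_cube_measure(1)[of k j] unfolding set_integrable_def Q
                by (intro integrable_mult_indicator) auto
            qed (auto simp: v0 Q dyadic_cube_measure)
            also have "(LINT y:Q|lebesgue. \<bar>f y\<bar> * v y) / measure lebesgue Q = t * a k j"
              using t by (simp add: a_def g_def Q)
            also have "ennreal (t * a k j) \<le> ennreal (t * v x)"
              using nT Q(2) t by (intro ennreal_leI mult_left_mono) (auto simp: mem_dyadic_cube_iff not_less)
            finally show "avg Q (\<lambda>y. ennreal \<bar>f y * v y\<bar>) \<le> ennreal (t * v x)" .
          qed
          then have "dyadic_maximal (\<lambda>y. f y * v y) x / ennreal (v x) \<le> ennreal (t * v x) / ennreal (v x)"
            by (rule divide_right_mono_ennreal)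
          also have "\<dots> = ennreal t" using vx t by (simp add: divide_ennreal)
          finally show False using x by simp
        qed
      qed
      have Z: "{x. v x = 0} \<in> sets lebesgue"
      proof -
        have "{x. v x = 0} = {x \<in> space lebesgue. v x = 0}" by simp
        also have "\<dots> \<in> sets lebesgue" using vm by measurable
        finally show ?thesis .
      qed
      have "emeasure (weight_measure v) {x. v x = 0} = (\<integral>\<^sup>+(x :: real ^ 'n). 0 \<partial>lebesgue)"
        unfolding emeasure_weight_measure[OF vm Z] by (intro nn_integral_cong) (auto simp: indicator_def)
      then have Z0: "emeasure (weight_measure v) {x. v x = 0} = 0" by simp
      have "emeasure (weight_measure v) {x. ennreal t < dyadic_maximal (\<lambda>y. f y * v y) x / ennreal (v x)}
          \<le> emeasure (weight_measure v) ({x. v x = 0} \<union> ?T)"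
        using sub Z T(1) by (intro emeasure_mono) (auto simp: weight_measure_def)
      also have "\<dots> \<le> emeasure (weight_measure v) {x. v x = 0} + emeasure (weight_measure v) ?T"
        using Z T(1) by (intro emeasure_subadditive) (auto simp: weight_measure_def)
      also have "\<dots> \<le> ?c * (\<integral>\<^sup>+x. ennreal (g x) \<partial>lebesgue)" using T(2) Z0 by simp
      finally have "ennreal t * emeasure (weight_measure v)
          {x. ennreal t < dyadic_maximal (\<lambda>y. f y * v y) x / ennreal (v x)}
        \<le> ennreal t * (?c * (\<integral>\<^sup>+x. ennreal (g x) \<partial>lebesgue))"
        by (rule mult_left_mono) simp
      also have "\<dots> = ?c * (ennreal t * (\<integral>\<^sup>+x. ennreal (g x) \<partial>lebesgue))"
        by (simp only: mult.left_commute)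
      also have "ennreal t * (\<integral>\<^sup>+x. ennreal (g x) \<partial>lebesgue) = (\<integral>\<^sup>+x. ennreal t * ennreal (g x) \<partial>lebesgue)"
        using g(1) by (intro nn_integral_cmult[symmetric]) (auto intro: borel_measurable_integrable)
      also have "\<dots> = L1_norm v f"
        unfolding L1_norm_def using t v0 g(2)
        by (intro nn_integral_cong) (simp add: g_def flip: ennreal_mult)
      also have "?c * L1_norm v f \<le> ennreal (11 * p * B) * L1_norm v f"
        using q p B(2) by (intro mult_right_mono ennreal_leI) auto
      finally show ?thesis .
    qed
    then show ?thesis unfolding weak_L1_norm_def by (intro SUP_least) auto
  qed
qed

theorem theorem1p15:
  shows "\<exists>c::real. 0 < c \<and>
    (\<forall>(p::real) (v :: real ^ 'n \<Rightarrow> real) (f :: real ^ 'n \<Rightarrow> real).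
       1 \<le> p \<longrightarrow> in_Ap p v \<longrightarrow> integrable (weight_measure v) f \<longrightarrow>
       weak_L1_norm v (\<lambda>x. dyadic_maximal (\<lambda>y. f y * v y) x / ennreal (v x))
         \<le> ennreal (c * p) * mixed_const p (1 / p) (1 / conj_exp p) v
             * ln_e_plus (mixed_const p (1 / p) (1 / conj_exp p) v) * L1_norm v f)"
proof (intro exI[of _ 11] conjI allI impI)
  fix p :: real and v f :: "real ^ 'n \<Rightarrow> real"
  assume p: "1 \<le> p" and v: "in_Ap p v" and f: "integrable (weight_measure v) f"
  let ?X = "mixed_const p (1 / p) (1 / conj_exp p) v"
  let ?w = "weak_L1_norm v (\<lambda>x. dyadic_maximal (\<lambda>y. f y * v y) x / ennreal (v x))"
  show "?w \<le> ennreal (11 * p) * ?X * ln_e_plus ?X * L1_norm v f"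
  proof (cases ?X)
    case (real B)
    have "?w \<le> ennreal (11 * p * B) * L1_norm v f"
      using real by (intro weak_L1_norm_bound v p f) auto
    also have "ennreal (11 * p * B) = ennreal (11 * p) * ?X * 1"
      using real p by (simp add: ennreal_mult)
    also have "\<dots> \<le> ennreal (11 * p) * ?X * ln_e_plus ?X"
    proof (rule mult_left_mono)
      \<comment> \<open>The logarithmic factor is at least \<open>ln (exp 1) = 1\<close>, so the
        bound without it is the stronger one.\<close>
      have "ln (exp 1) \<le> ln (exp 1 + B)" using real by (intro ln_mono) auto
      then have "ennreal 1 \<le> ennreal (ln (exp 1 + B))" by (intro ennreal_leI) simp
      then show "1 \<le> ln_e_plus ?X" using real by (simp add: ln_e_plus_def)
    qed simp
    finally show ?thesis by (simp add: mult_right_mono)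
  next
    \<comment> \<open>An infinite constant makes the right side \<open>top\<close>, except that
      \<open>top * 0 = 0\<close> when \<open>f\<close> has norm zero; then all averages of
      \<open>f v\<close> vanish and the left side is \<open>0\<close>.\<close>
    case top
    show ?thesis
    proof (cases "L1_norm v f = 0")
      case True
      have v0: "0 \<le> v x" for x using v by (simp add: in_Ap_def weight_def)
      have "avg Q (\<lambda>y. ennreal \<bar>f y * v y\<bar>) = 0" for Q
      proof -
        have "(\<integral>\<^sup>+y\<in>Q. ennreal \<bar>f y * v y\<bar> \<partial>lebesgue) \<le> L1_norm v f"
          unfolding L1_norm_def by (intro nn_integral_mono) (auto simp: indicator_def abs_mult v0)
        then show ?thesis using True by (simp add: avg_def)
      qed
      then have "dyadic_maximal (\<lambda>y. f y * v y) x = 0" for x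
        by (simp add: dyadic_maximal_def bot_ennreal[symmetric])
      then show ?thesis by (simp add: weak_L1_norm_def)
    next
      case False
      then have "ennreal (11 * p) * ?X * ln_e_plus ?X * L1_norm v f = top"
        using top p by (simp add: ln_e_plus_def ennreal_mult_top ennreal_top_mult ennreal_eq_0_iff)
      then show ?thesis by simp
    qed
  qed
qed simp

end
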